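(* Let $G$ be a $4$-edge-connected graph and $r\in V(G)$. Then $G$ has a chain decomposition rooted at $r$.
   Context: Graphs are multigraphs (parallel edges and loops allowed; a loop adds $2$ to the degree; a loop is a cycle of length one and two parallel edges form a cycle of length two). Paths and cycles are simple. Fix $r\in V(G)$. The degree of a vertex in a subgraph not containing it is $0$. An up chain of $G$ with respect to a pair of edge-disjoint subgraphs $(H,\overline{H})$ is a subgraph of $G$, edge-disjoint from $H$ and $\overline{H}$, which is either (i) a path with at least one edge such that every vertex is either $r$ or has degree at least two in $\overline{H}$, and each end is either $r$ or lies in $H$; or (ii) a cycle such that every vertex is either $r$ or has degree at least two in $\overline{H}$, and some vertex $v$ of it is either $r$ or has degree at least two in $H$ ($v$ is regarded as both ends of the chain, all other vertices as internal). A down chain with respect to $(H,\overline{H})$ is an up chain with respect to $(\overline{H},H)$. A one-way chain with respect to $(H,\overline{H})$ is the subgraph induced by a single edge $e\notin E(H)\cup E(\overline{H})$ with ends $u$ (tail) and $v$ (head) such that $u$ is $r$ or has degree at least two in $H$, and $v$ is $r$ or has degree at least two in $\overline{H}$. A sequence $G_0,\dots,G_m$ of subgraphs of $G$ is a chain decomposition of $G$ rooted at $r$ if, writing $H_i=G_0\cup\cdots\cup G_{i-1}$ and $\overline{H_i}=G_{i+1}\cup\cdots\cup G_m$ (so $H_0$ and $\overline{H_m}$ are the null graph), the sets $E(G_0),\dots,E(G_m)$ partition $E(G)$ and for each $i=0,\dots,m$ the subgraph $G_i$ is an up chain, a down chain, or a one-way chain with respect to $(H_i,\overline{H_i})$.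 *)

theory Defs
  imports Main "HOL-Library.Uprod" "HOL-Library.Disjoint_Sets"
begin

record ('v, 'e) mgraph =
  verts :: "'v set"
  edges :: "'e set"
  ends :: "'e \<Rightarrow> 'v uprod"

text \<open>An edge \<open>e\<close> is a loop at \<open>v\<close> iff \<open>ends e = Upair v v\<close>. The values of \<open>ends\<close>
  outside \<open>edges\<close> are irrelevant.\<close>

definition multigraph :: "('v, 'e) mgraph \<Rightarrow> bool" where
  "multigraph G \<longleftrightarrow> finite (verts G) \<and> finite (edges G) \<and>
     (\<forall>e \<in> edges G. set_uprod (ends G e) \<subseteq> verts G)"

text \<open>The second summand makes a loop contribute 2. If \<open>G\<close> is a multigraph and \<open>v\<close> is not
  one of its vertices, the value is 0.\<close>

definition degree :: "('v, 'e) mgraph \<Rightarrow> 'v \<Rightarrow> nat" where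
  "degree G v = card {e \<in> edges G. v \<in> set_uprod (ends G e)} +
                card {e \<in> edges G. ends G e = Upair v v}"

text \<open>Subgraphs of \<open>G\<close> keep the whole map \<open>ends G\<close>, so that a subgraph is determined by its
  vertex set and its edge set.\<close>

definition subgraph :: "('v, 'e) mgraph \<Rightarrow> ('v, 'e) mgraph \<Rightarrow> bool" where
  "subgraph H G \<longleftrightarrow> multigraph H \<and> verts H \<subseteq> verts G \<and> edges H \<subseteq> edges G \<and> ends H = ends G"

definition edge_disjoint :: "('v, 'e) mgraph \<Rightarrow> ('v, 'e) mgraph \<Rightarrow> bool" where
  "edge_disjoint H K \<longleftrightarrow> edges H \<inter> edges K = {}"

text \<open>Union of a family of subgraphs of \<open>G\<close>; the empty family gives the null graph.\<close>

definition union_subgraphs ::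
    "('v, 'e) mgraph \<Rightarrow> (nat \<Rightarrow> ('v, 'e) mgraph) \<Rightarrow> nat set \<Rightarrow> ('v, 'e) mgraph" where
  "union_subgraphs G C I =
     \<lparr>verts = (\<Union>i\<in>I. verts (C i)), edges = (\<Union>i\<in>I. edges (C i)), ends = ends G\<rparr>"

definition delete_edges :: "('v, 'e) mgraph \<Rightarrow> 'e set \<Rightarrow> ('v, 'e) mgraph" where
  "delete_edges G F = G\<lparr>edges := edges G - F\<rparr>"

text \<open>The graph \<open>P\<close> is a simple path whose ends are \<open>u\<close> and \<open>v\<close>; \<open>xs\<close> and \<open>es\<close> list its
  vertices and edges in order. A single vertex is a path with \<open>u = v\<close>.\<close>

definition path_between :: "('v, 'e) mgraph \<Rightarrow> 'v \<Rightarrow> 'v \<Rightarrow> bool" where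
  "path_between P u v \<longleftrightarrow>
     (\<exists>xs es. length xs = Suc (length es) \<and> distinct xs \<and>
        verts P = set xs \<and> edges P = set es \<and> hd xs = u \<and> last xs = v \<and>
        (\<forall>i < length es. ends P (es ! i) = Upair (xs ! i) (xs ! Suc i)))"

text \<open>Distinctness of \<open>es\<close> matters only for length two, where it forces two parallel edges.
  For length one the condition says that the only edge is a loop.\<close>

definition is_cycle :: "('v, 'e) mgraph \<Rightarrow> bool" where
  "is_cycle Z \<longleftrightarrow>
     (\<exists>xs es. xs \<noteq> [] \<and> length xs = length es \<and> distinct xs \<and> distinct es \<and>
        verts Z = set xs \<and> edges Z = set es \<and>
        (\<forall>i < length es. ends Z (es ! i) = Upair (xs ! i) (xs ! (Suc i mod length xs))))"

definition connected_graph :: "('v, 'e) mgraph \<Rightarrow> bool" where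
  "connected_graph G \<longleftrightarrow> verts G \<noteq> {} \<and>
     (\<forall>u \<in> verts G. \<forall>v \<in> verts G. \<exists>P. subgraph P G \<and> path_between P u v)"

text \<open>As usual, a graph with a single vertex is not \<open>k\<close>-edge-connected for any \<open>k\<close>.\<close>

definition edge_connected :: "nat \<Rightarrow> ('v, 'e) mgraph \<Rightarrow> bool" where
  "edge_connected k G \<longleftrightarrow> card (verts G) \<ge> 2 \<and>
     (\<forall>F \<subseteq> edges G. card F < k \<longrightarrow> connected_graph (delete_edges G F))"

definition up_chain ::
    "('v, 'e) mgraph \<Rightarrow> 'v \<Rightarrow> ('v, 'e) mgraph \<Rightarrow> ('v, 'e) mgraph \<Rightarrow> ('v, 'e) mgraph \<Rightarrow> bool" where
  "up_chain G r H H' C \<longleftrightarrow>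
     subgraph H G \<and> subgraph H' G \<and> edge_disjoint H H' \<and>
     subgraph C G \<and> edge_disjoint C H \<and> edge_disjoint C H' \<and>
     ((\<exists>u v. path_between C u v \<and> edges C \<noteq> {} \<and>
         (\<forall>x \<in> verts C. x = r \<or> degree H' x \<ge> 2) \<and>
         (u = r \<or> u \<in> verts H) \<and> (v = r \<or> v \<in> verts H)) \<or>
      (is_cycle C \<and>
         (\<forall>x \<in> verts C. x = r \<or> degree H' x \<ge> 2) \<and>
         (\<exists>v \<in> verts C. v = r \<or> degree H v \<ge> 2)))"

definition down_chain ::
    "('v, 'e) mgraph \<Rightarrow> 'v \<Rightarrow> ('v, 'e) mgraph \<Rightarrow> ('v, 'e) mgraph \<Rightarrow> ('v, 'e) mgraph \<Rightarrow> bool" where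
  "down_chain G r H H' C \<longleftrightarrow> up_chain G r H' H C"

definition one_way_chain ::
    "('v, 'e) mgraph \<Rightarrow> 'v \<Rightarrow> ('v, 'e) mgraph \<Rightarrow> ('v, 'e) mgraph \<Rightarrow> ('v, 'e) mgraph \<Rightarrow> bool" where
  "one_way_chain G r H H' C \<longleftrightarrow>
     subgraph H G \<and> subgraph H' G \<and> edge_disjoint H H' \<and>
     (\<exists>e u v. e \<in> edges G \<and> e \<notin> edges H \<union> edges H' \<and> ends G e = Upair u v \<and>
        C = \<lparr>verts = {u, v}, edges = {e}, ends = ends G\<rparr> \<and>
        (u = r \<or> degree H u \<ge> 2) \<and> (v = r \<or> degree H' v \<ge> 2))"

text \<open>The decomposition is \<open>C 0, \<dots>, C m\<close>; values of \<open>C\<close> beyond \<open>m\<close> are irrelevant.\<close>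

definition chain_decomposition ::
    "('v, 'e) mgraph \<Rightarrow> 'v \<Rightarrow> nat \<Rightarrow> (nat \<Rightarrow> ('v, 'e) mgraph) \<Rightarrow> bool" where
  "chain_decomposition G r m C \<longleftrightarrow>
     (\<forall>i \<le> m. subgraph (C i) G \<and> edges (C i) \<noteq> {}) \<and>
     disjoint_family_on (\<lambda>i. edges (C i)) {..m} \<and>
     (\<Union>i\<le>m. edges (C i)) = edges G \<and>
     (\<forall>i \<le> m.
        let H = union_subgraphs G C {..<i}; H' = union_subgraphs G C {i<..m}
        in up_chain G r H H' (C i) \<or> down_chain G r H H' (C i) \<or> one_way_chain G r H H' (C i))"

end

theory Submission
  imports Defs "HOL-Library.Multiset"
begin

text \<open>The chains are obtained from a stronger ordered decomposition into ears. Write \<open>h v\<close> and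
  \<open>k v\<close> for the numbers of edges at \<open>v\<close> in earlier and later ears. Every vertex other than \<open>r\<close> enters
  as an inner vertex of a rising ear, so it has at least two earlier edges ever after; the edges
  between vertices that have entered are collected by falling ears, which are down chains, and by
  single bridging edges, which are one-way chains.

  Such a decomposition is built by induction on the number of edges. If some edge \<open>xy\<close> lies in no
  4-edge cut, delete it and reinsert it at the moment when both ends have entered and one of them
  still has two later edges. Otherwise, by Mader, some vertex \<open>w \<noteq> r\<close> has degree four, and by Lovasz
  its edges can be split off in two pairs, giving edges \<open>e\<close> and \<open>f\<close> of a smaller graph. To undo this,
  \<open>e\<close> and \<open>f\<close> are pinched together at \<open>w\<close>: \<open>w\<close> enters at the earlier one and leaves at the later one.
  The only difficulty is a later edge whose end \<open>s\<close> has no further edge; its half \<open>sw\<close> is then moved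
  back to the previous ear through \<open>s\<close>, or, if that comes no later than the ear of \<open>e\<close>, to the ear
  of \<open>e\<close>.\<close>

subsection \<open>Walks and degrees\<close>

text \<open>Why four: a vertex other than \<open>r\<close> enters on a rising ear with exactly two
  edges, so at least two of its edges are still to come. Hence there is a moment at which it has two
  edges on either side. This is the place for a deleted edge, and in the end it provides the later
  edges that up chains and one-way chains ask for. What makes local replacement possible: an ear
  sees the rest only through the degrees at its own vertices. Pinching in place changes degrees at
  \<open>w\<close> alone, and no old ear passes through \<open>w\<close>, so the other ears survive.
  Moving a half edge \<open>sw\<close> to an earlier place breaks this, since the degrees at
  \<open>s\<close> change between the two places; moving it to the last possible ear through
  \<open>s\<close> confines the change to ears that avoid \<open>s\<close>. The induction speaks of
  cut sizes instead of paths because these are easy to follow under deletion and splitting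
  off.\<close>

definition inc :: "'v uprod \<Rightarrow> 'v \<Rightarrow> nat" where
  "inc a v = (if v \<in> set_uprod a then 1 else 0) + (if a = Upair v v then 1 else 0)"

lemma inc_Upair [simp]:
  "inc (Upair a b) v = (if v = a then 1 else 0) + (if v = b then 1 else 0)"
  by (auto simp: inc_def)

text \<open>The start is kept apart and each edge is paired with the vertex it leads to, so that
  cutting a walk at an edge is a list decomposition \<open>p @ (e, y) # q\<close>.\<close>

fun walk :: "('e \<Rightarrow> 'v uprod) \<Rightarrow> 'v \<Rightarrow> ('e \<times> 'v) list \<Rightarrow> bool" where
  "walk i u [] \<longleftrightarrow> True"
| "walk i u ((e, x) # p) \<longleftrightarrow> i e = Upair u x \<and> walk i x p"

fun target :: "'v \<Rightarrow> ('e \<times> 'v) list \<Rightarrow> 'v" where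
  "target u [] = u"
| "target u ((e, x) # p) = target x p"

fun reversal :: "'v \<Rightarrow> ('e \<times> 'v) list \<Rightarrow> ('e \<times> 'v) list" where
  "reversal u [] = []"
| "reversal u ((e, x) # p) = reversal x p @ [(e, u)]"

text \<open>Neither end is listed: the start is not in \<open>p\<close>, and \<open>butlast\<close>
  drops the last vertex. So \<open>distinct (inner p)\<close> serves open and closed ears
  alike.\<close>

definition inner :: "('e \<times> 'v) list \<Rightarrow> 'v list" where
  "inner p = map snd (butlast p)"

definition walk_edges :: "('e \<times> 'v) list \<Rightarrow> 'e multiset" where
  "walk_edges p = mset (map fst p)"

text \<open>Multisets make every replacement an additive identity, and equality with
  \<open>mset_set\<close> finally says both that the ears are edge-disjoint and that they cover all
  edges.\<close>

definition edges_of :: "('v \<times> ('e \<times> 'v) list) list \<Rightarrow> 'e multiset" where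
  "edges_of cs = (\<Sum>c\<leftarrow>cs. walk_edges (snd c))"

definition walk_verts :: "'v \<times> ('e \<times> 'v) list \<Rightarrow> 'v set" where
  "walk_verts c = insert (fst c) (snd ` set (snd c))"

definition deg :: "('e \<Rightarrow> 'v uprod) \<Rightarrow> 'e multiset \<Rightarrow> 'v \<Rightarrow> nat" where
  "deg i M v = (\<Sum>e\<in>#M. inc (i e) v)"

lemma deg_simps [simp]:
  "deg i {#} = (\<lambda>v. 0)" "deg i (M + N) = (\<lambda>v. deg i M v + deg i N v)"
  "deg i (add_mset e M) = (\<lambda>v. inc (i e) v + deg i M v)"
  by (auto simp: deg_def)

lemma walk_edges_simps [simp]:
  "walk_edges [] = {#}" "walk_edges (d # p) = add_mset (fst d) (walk_edges p)"
  "walk_edges (p @ q) = walk_edges p + walk_edges q"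
  by (auto simp: walk_edges_def)

lemma edges_of_simps [simp]:
  "edges_of [] = {#}" "edges_of (c # cs) = walk_edges (snd c) + edges_of cs"
  "edges_of (cs @ ds) = edges_of cs + edges_of ds"
  by (auto simp: edges_of_def)

lemma walk_verts_Pair: "walk_verts (u, p) = insert u (snd ` set p)"
  by (simp add: walk_verts_def)

lemma inner_simps [simp]:
  "inner [] = []" "inner (d # p) = (if p = [] then [] else snd d # inner p)"
  "inner (p @ d # q) = map snd p @ inner (d # q)"
  by (auto simp: inner_def butlast_append)

lemma walk_append [simp]: "walk i u (p @ q) \<longleftrightarrow> walk i u p \<and> walk i (target u p) q"
  by (induction u p rule: target.induct) auto

lemma target_append [simp]: "target u (p @ q) = target (target u p) q"
  by (induction u p rule: target.induct) auto

lemma map_snd_conv: "p \<noteq> [] \<Longrightarrow> map snd p = inner p @ [target u p]"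
proof (induction u p rule: target.induct)
  case (2 u e x p)
  then show ?case by (cases p) auto
qed simp

lemma set_inner_Cons: "p \<noteq> [] \<Longrightarrow> snd ` set p = insert (target u p) (set (inner p))"
  using arg_cong[OF map_snd_conv, of p set u] by auto

lemma target_in: "p \<noteq> [] \<Longrightarrow> target u p \<in> snd ` set p"
  by (metis insertI1 set_inner_Cons)

lemma target_in_verts: "target u p = u \<or> target u p \<in> snd ` set p"
  by (cases "p = []") (auto dest: target_in[of p u])

lemma inner_subset: "set (inner p) \<subseteq> snd ` set p"
  unfolding inner_def by (auto dest: in_set_butlastD)

lemma walk_verts_conv: "p \<noteq> [] \<Longrightarrow> walk_verts (u, p) = insert u (insert (target u p) (set (inner p)))"
  by (simp add: walk_verts_Pair set_inner_Cons[of p u])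

lemma reversal_append [simp]: "reversal u (p @ q) = reversal (target u p) q @ reversal u p"
  by (induction u p rule: target.induct) auto

lemma target_reversal [simp]: "target (target u p) (reversal u p) = u"
  by (induction u p rule: target.induct) auto

lemma walk_reversal: "walk i u p \<Longrightarrow> walk i (target u p) (reversal u p)"
  by (induction u p rule: target.induct) (auto simp: Upair_inject)

lemma walk_edges_reversal [simp]: "walk_edges (reversal u p) = walk_edges p"
  by (induction u p rule: target.induct) auto

lemma length_reversal [simp]: "length (reversal u p) = length p"
  by (induction u p rule: target.induct) auto

lemma reversal_eq_Nil [simp]: "reversal u p = [] \<longleftrightarrow> p = []"
  by (metis length_0_conv length_reversal)

lemma snd_reversal: "target u p # map snd (reversal u p) = rev (u # map snd p)"
  by (induction u p rule: target.induct) auto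

lemma inner_reversal [simp]: "inner (reversal u p) = rev (inner p)"
proof (cases "p = []")
  case False
  have "target u p # inner (reversal u p) @ [u] = target u p # map snd (reversal u p)"
    using map_snd_conv[of "reversal u p" "target u p"] False by simp
  also have "\<dots> = rev (u # map snd p)" by (rule snd_reversal)
  also have "\<dots> = target u p # rev (inner p) @ [u]"
    using map_snd_conv[of p u] False by simp
  finally show ?thesis by simp
qed simp

lemma walk_verts_reversal [simp]: "walk_verts (target u p, reversal u p) = walk_verts (u, p)"
proof -
  have "set (target u p # map snd (reversal u p)) = set (u # map snd p)"
    unfolding snd_reversal by simp
  then show ?thesis by (simp add: walk_verts_Pair)
qed

text \<open>Each visit of a vertex uses two half edges, except that the start and the last vertex
  lack one each; the two extra terms make up for these.\<close>

lemma deg_walk: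
  "walk i u p \<Longrightarrow> deg i (walk_edges p) v + (if v = u then 1 else 0) + (if v = target u p then 1 else 0)
     = 2 * count_list (u # map snd p) v"
  by (induction u p rule: target.induct) (auto split: if_splits)

lemma deg_walk_notin: "walk i u p \<Longrightarrow> v \<notin> walk_verts (u, p) \<Longrightarrow> deg i (walk_edges p) v = 0"
  using deg_walk[of i u p v] by (auto simp: walk_verts_Pair count_list_0_iff)

lemma deg_walk_pos: "walk i u p \<Longrightarrow> p \<noteq> [] \<Longrightarrow> v \<in> walk_verts (u, p) \<Longrightarrow> deg i (walk_edges p) v > 0"
proof (induction u p rule: target.induct)
  case (2 u e x p)
  then show ?case by (cases p) (fastforce simp: walk_verts_Pair)+
qed simp

lemma deg_walk_inner:
  assumes "walk i u p" "distinct (inner p)" "u \<notin> set (inner p)" "target u p \<notin> set (inner p)"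
    and "v \<in> set (inner p)"
  shows "deg i (walk_edges p) v = 2"
proof -
  have ne: "p \<noteq> []" using assms(5) by auto
  have "count_list (inner p) v = 1"
    using assms(2,5) by (metis One_nat_def distinct_count_atmost_1 count_mset)
  then have "count_list (u # map snd p) v = 1"
    using assms map_snd_conv[OF ne, of u] by (auto simp: count_list_0_iff)
  then show ?thesis using deg_walk[OF assms(1), of v] assms by (auto split: if_splits)
qed

subsection \<open>Ears\<close>

text \<open>Here \<open>h\<close> and \<open>k\<close> give the degrees in the edges before and after the whole list.\<close>

fun staged :: "(('v \<Rightarrow> nat) \<Rightarrow> ('v \<Rightarrow> nat) \<Rightarrow> 'v \<times> ('e \<times> 'v) list \<Rightarrow> bool) \<Rightarrow>
    ('e \<Rightarrow> 'v uprod) \<Rightarrow> ('v \<Rightarrow> nat) \<Rightarrow> ('v \<times> ('e \<times> 'v) list) list \<Rightarrow> ('v \<Rightarrow> nat) \<Rightarrow> bool" where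
  "staged Q i h [] k \<longleftrightarrow> True"
| "staged Q i h (c # cs) k \<longleftrightarrow>
     Q h (\<lambda>v. deg i (edges_of cs) v + k v) c \<and>
     staged Q i (\<lambda>v. h v + deg i (walk_edges (snd c)) v) cs k"

lemma staged_append [simp]:
  "staged Q i h (cs @ ds) k \<longleftrightarrow> staged Q i h cs (\<lambda>v. deg i (edges_of ds) v + k v) \<and>
     staged Q i (\<lambda>v. h v + deg i (edges_of cs) v) ds k"
  by (induction cs arbitrary: h) (auto simp: add.assoc)

text \<open>Applied to earlier degrees \<open>h\<close> and to later degrees \<open>k\<close> alike;
  for \<open>k\<close> it means that two edges are still to come.\<close>

definition late :: "'v \<Rightarrow> ('v \<Rightarrow> nat) \<Rightarrow> 'v \<Rightarrow> bool" where
  "late r h v \<longleftrightarrow> v = r \<or> h v \<ge> 2"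

definition met :: "'v \<Rightarrow> ('v \<Rightarrow> nat) \<Rightarrow> 'v \<Rightarrow> bool" where
  "met r h v \<longleftrightarrow> v = r \<or> h v \<ge> 1"

text \<open>The bound on the length guarantees a new vertex. The two ends may coincide: at the
  outset only \<open>r\<close> is late, so a first rising ear has to be closed at
  \<open>r\<close>.\<close>

definition rising :: "'v \<Rightarrow> ('v \<Rightarrow> nat) \<Rightarrow> 'v \<Rightarrow> ('e \<times> 'v) list \<Rightarrow> bool" where
  "rising r h u p \<longleftrightarrow> length p \<ge> 2 \<and> late r h u \<and> late r h (target u p) \<and>
     (\<forall>x \<in> set (inner p). x \<noteq> r \<and> h x = 0)"

text \<open>The last clause concerns closed ears: a down chain that is a cycle needs later degree
  two at its end, not just one later edge.\<close>

definition falling :: "'v \<Rightarrow> ('v \<Rightarrow> nat) \<Rightarrow> ('v \<Rightarrow> nat) \<Rightarrow> 'v \<Rightarrow> ('e \<times> 'v) list \<Rightarrow> bool" where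
  "falling r h k u p \<longleftrightarrow> (\<forall>x \<in> walk_verts (u, p). late r h x) \<and> met r k u \<and> met r k (target u p) \<and>
     (u = target u p \<longrightarrow> late r k u)"

text \<open>Symmetric in the two ends: as both are late in \<open>h\<close>, the edge can be
  directed towards an end that is late in \<open>k\<close>, which gives a one-way chain.\<close>

definition bridging :: "'v \<Rightarrow> ('v \<Rightarrow> nat) \<Rightarrow> ('v \<Rightarrow> nat) \<Rightarrow> 'v \<Rightarrow> ('e \<times> 'v) list \<Rightarrow> bool" where
  "bridging r h k u p \<longleftrightarrow> length p = 1 \<and> late r h u \<and> late r h (target u p) \<and>
     (late r k u \<or> late r k (target u p))"

fun ear :: "('e \<Rightarrow> 'v uprod) \<Rightarrow> 'v \<Rightarrow> ('v \<Rightarrow> nat) \<Rightarrow> ('v \<Rightarrow> nat) \<Rightarrow> 'v \<times> ('e \<times> 'v) list \<Rightarrow> bool" where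
  "ear i r h k (u, p) \<longleftrightarrow> p \<noteq> [] \<and> walk i u p \<and> distinct (inner p) \<and>
     u \<notin> set (inner p) \<and> target u p \<notin> set (inner p) \<and>
     (rising r h u p \<or> falling r h k u p \<or> bridging r h k u p)"

lemma earD:
  assumes "ear i r h k (u, p)"
  shows "p \<noteq> []" "walk i u p" "distinct (inner p)" "u \<notin> set (inner p)" "target u p \<notin> set (inner p)"
  using assms by auto

lemma ear_cases:
  assumes "ear i r h k (u, p)"
  obtains (rising) "rising r h u p" | (falling) "falling r h k u p" | (bridging) "bridging r h k u p"
  using assms by auto

text \<open>The locality on which all replacements rest: changes of degree away from an ear do not
  affect it.\<close>

lemma ear_cong:
  assumes "ear i r h k c" "\<And>v. v \<in> walk_verts c \<Longrightarrow> h v = h' v \<and> k v = k' v"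
  shows "ear i r h' k' c"
proof (cases c)
  case (Pair u p)
  have "p \<noteq> []" using assms(1) Pair by simp
  then show ?thesis using assms
    by (auto simp: Pair walk_verts_conv[of p u] late_def met_def rising_def falling_def bridging_def)
qed

text \<open>More edges elsewhere never hurt, except earlier ones at a new inner vertex of a rising
  ear; the last assumption excludes these.\<close>

lemma ear_mono:
  assumes "ear i r h k c" "\<And>v. h v \<le> h' v" "\<And>v. k v \<le> k' v"
    and "\<And>v. v \<noteq> r \<Longrightarrow> h v = 0 \<Longrightarrow> h' v = 0"
  shows "ear i r h' k' c"
proof -
  have "late r h v \<Longrightarrow> late r h' v" "late r k v \<Longrightarrow> late r k' v" "met r k v \<Longrightarrow> met r k' v" for v
    using assms(2,3)[of v] by (auto simp: late_def met_def)
  then show ?thesis using assms(1,4)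
    by (cases c) (auto simp: rising_def falling_def bridging_def)
qed

lemma staged_cong:
  assumes "staged (ear i r) i h cs k"
    and "\<And>c v. c \<in> set cs \<Longrightarrow> v \<in> walk_verts c \<Longrightarrow> h v = h' v \<and> k v = k' v"
  shows "staged (ear i r) i h' cs k'"
  using assms
proof (induction cs arbitrary: h h')
  case (Cons c cs)
  have "ear i r h' (\<lambda>v. deg i (edges_of cs) v + k' v) c"
    using Cons.prems(1) Cons.prems(2)[of c] by (auto elim!: ear_cong)
  moreover have "staged (ear i r) i (\<lambda>v. h' v + deg i (walk_edges (snd c)) v) cs k'"
    using Cons.prems by (intro Cons.IH[of "\<lambda>v. h v + deg i (walk_edges (snd c)) v"]) auto
  ultimately show ?case by simp
qed simp

lemma staged_mono:
  assumes "staged (ear i r) i h cs k" "\<And>v. h v \<le> h' v" "\<And>v. k v \<le> k' v"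
    and "\<And>v. v \<noteq> r \<Longrightarrow> h v = 0 \<Longrightarrow> h' v = 0"
  shows "staged (ear i r) i h' cs k'"
  using assms
proof (induction cs arbitrary: h h')
  case (Cons c cs)
  have "ear i r h' (\<lambda>v. deg i (edges_of cs) v + k' v) c"
    using Cons.prems by (auto elim!: ear_mono)
  moreover have "staged (ear i r) i (\<lambda>v. h' v + deg i (walk_edges (snd c)) v) cs k'"
    using Cons.prems by (intro Cons.IH[of "\<lambda>v. h v + deg i (walk_edges (snd c)) v"]) auto
  ultimately show ?case by simp
qed simp

lemma ear_reversal:
  assumes "ear i r h k (u, p)"
  shows "ear i r h k (target u p, reversal u p)"
  using assms walk_reversal[of i u p]
  by (auto simp: rising_def falling_def bridging_def)

text \<open>Lets an argument about the part of an ear before an edge be applied to the part after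
  it.\<close>

lemma ear_flip:
  assumes "ear i r h k (u, p @ (e, y) # q)"
  defines "p' \<equiv> reversal y q" and "q' \<equiv> reversal u p"
    and "u' \<equiv> target y q" and "x \<equiv> target u p"
  shows "ear i r h k (u', p' @ (e, x) # q')" "target u' p' = y" "target x q' = u"
    "walk_edges (p' @ (e, x) # q') = walk_edges (p @ (e, y) # q)"
    "walk_verts (u', p' @ (e, x) # q') = walk_verts (u, p @ (e, y) # q)"
  using ear_reversal[OF assms(1)] walk_verts_reversal[of u "p @ (e, y) # q"]
  by (auto simp: p'_def q'_def u'_def x_def)

text \<open>Falling and bridging ears visit only late vertices, so a vertex can enter only inside a
  rising ear, and then with exactly two edges.\<close>

lemma ear_not_late:
  assumes "ear i r h k (u, p)" "v \<in> walk_verts (u, p)" "\<not> late r h v"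
  shows "rising r h u p" "v \<in> set (inner p)" "h v = 0" "deg i (walk_edges p) v = 2"
proof -
  have ne: "p \<noteq> []" using assms by simp
  have v: "v = u \<or> v = target u p \<or> v \<in> set (inner p)"
    using assms(2) walk_verts_conv[OF ne, of u] by auto
  have "\<not> falling r h k u p" using assms(2,3) by (auto simp: falling_def)
  moreover have "\<not> bridging r h k u p"
  proof
    assume b: "bridging r h k u p"
    then have "inner p = []" by (auto simp: bridging_def length_Suc_conv)
    then show False using v b assms(3) by (auto simp: bridging_def)
  qed
  ultimately show r: "rising r h u p" using assms(1) by auto
  then show iv: "v \<in> set (inner p)" using v assms(3) by (auto simp: rising_def)
  then show "h v = 0" using r by (auto simp: rising_def)
  show "deg i (walk_edges p) v = 2" using assms(1) iv by (intro deg_walk_inner[of i u p]) auto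
qed

declare ear.simps [simp del]

text \<open>Cutting an ear at an edge can leave an empty piece, which is no ear and has to be
  dropped.\<close>

definition nontrivial :: "'v \<Rightarrow> ('e \<times> 'v) list \<Rightarrow> ('v \<times> ('e \<times> 'v) list) list" where
  "nontrivial u p = (if p = [] then [] else [(u, p)])"

lemma edges_of_nontrivial [simp]: "edges_of (nontrivial u p) = walk_edges p"
  by (simp add: nontrivial_def)

lemma staged_nontrivial [simp]:
  "staged Q i h (nontrivial u p) k \<longleftrightarrow> (p \<noteq> [] \<longrightarrow> Q h k (u, p))"
  by (simp add: nontrivial_def)

lemma late_mono: "late r h v \<Longrightarrow> h v \<le> h' v \<Longrightarrow> late r h' v"
  by (auto simp: late_def)

lemma fallingI:
  assumes "p \<noteq> []" "walk i u p" "distinct (inner p)" "u \<notin> set (inner p)" "target u p \<notin> set (inner p)"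
    and "\<And>x. x \<in> walk_verts (u, p) \<Longrightarrow> late r h x" "met r k u" "met r k (target u p)"
    and "u = target u p \<Longrightarrow> late r k u"
  shows "ear i r h k (u, p)"
  using assms by (auto simp: falling_def ear.simps)

lemma risingI:
  assumes "length p \<ge> 2" "walk i u p" "distinct (inner p)"
    and "late r h u" "late r h (target u p)" "\<And>x. x \<in> set (inner p) \<Longrightarrow> x \<noteq> r \<and> h x = 0"
  shows "ear i r h k (u, p)"
proof -
  have "u \<notin> set (inner p)" "target u p \<notin> set (inner p)"
    using assms(4-6) by (fastforce simp: late_def)+
  then show ?thesis using assms by (auto simp: rising_def ear.simps)
qed

text \<open>Even a closed ear falls into open pieces when an edge is taken out; this disposes of the
  extra condition on closed falling ears.\<close>

lemma ear_split:
  assumes "ear i r h k (u, p @ (e, y) # q)"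
  shows "p \<noteq> [] \<Longrightarrow> distinct (inner p) \<and> u \<notin> set (inner p) \<and> target u p \<notin> set (inner p) \<and> u \<noteq> target u p"
    and "q \<noteq> [] \<Longrightarrow> distinct (inner q) \<and> y \<notin> set (inner q) \<and> target y q \<notin> set (inner q) \<and> target y q \<noteq> y"
    and "walk i u p" "i e = Upair (target u p) y" "walk i y q"
proof -
  assume "p \<noteq> []"
  then show "distinct (inner p) \<and> u \<notin> set (inner p) \<and> target u p \<notin> set (inner p) \<and> u \<noteq> target u p"
    using earD[OF assms] map_snd_conv[of p u] by (auto split: if_splits)
next
  assume "q \<noteq> []"
  then show "distinct (inner q) \<and> y \<notin> set (inner q) \<and> target y q \<notin> set (inner q) \<and> target y q \<noteq> y"
    using earD[OF assms] by (auto split: if_splits)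
qed (use earD[OF assms] in auto)

subsection \<open>Pinching two edges at a new vertex\<close>

text \<open>Pinching \<open>e = xy\<close> and \<open>f = st\<close> at \<open>w\<close> replaces them by \<open>ea = xw\<close>, \<open>eb = yw\<close>, \<open>fa = sw\<close> and
  \<open>fb = tw\<close>. In \<open>pinch_first\<close> the two edges of \<open>w\<close> coming from \<open>f\<close> are later, hence \<open>k' w \<ge> 2\<close>;
  in \<open>pinch_last\<close> those coming from \<open>e\<close> are earlier, hence \<open>h' w \<ge> 2\<close>.\<close>

lemma pinch_first:
  assumes c: "ear i r h k (u, p @ (e, y) # q)"
    and ids: "i ea = Upair (target u p) w" "i eb = Upair y w"
    and w: "w \<noteq> r" "w \<notin> walk_verts (u, p @ (e, y) # q)" "h w = 0"
    and k': "\<And>v. v \<noteq> w \<Longrightarrow> k' v = k v" "k' w \<ge> 2"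
  shows "\<exists>N. staged (ear i r) i h N k' \<and>
    add_mset e (edges_of N) = walk_edges (p @ (e, y) # q) + {#ea, eb#}"
proof -
  let ?x = "target u p"
  have ids': "i eb = Upair w y" using ids by (simp add: Upair_inject)
  have wv: "w \<noteq> u" "w \<notin> snd ` set p" "w \<noteq> y" "w \<notin> snd ` set q" "w \<noteq> ?x" "w \<noteq> target y q"
    using w(2) target_in_verts[of u p] target_in_verts[of y q] by (auto simp: walk_verts_Pair)
  show ?thesis
  proof (cases "rising r h u (p @ (e, y) # q)")
    case True
    have "w \<notin> set (inner q)" using wv inner_subset[of q] by auto
    \<comment> \<open>\<open>w\<close> is new like the other inner vertices, so subdividing
      \<open>e\<close> keeps the ear rising.\<close>
    then have "ear i r h k' (u, p @ (ea, w) # (eb, y) # q)"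
      using True earD[OF c] ids' ids w wv by (intro risingI) (auto simp: rising_def split: if_splits)
    then show ?thesis by (intro exI[of _ "[(u, p @ (ea, w) # (eb, y) # q)]"]) simp
  next
    case False
    \<comment> \<open>All vertices of the ear are late already, so \<open>w\<close> enters on the
      short ear from \<open>?x\<close> to \<open>y\<close>. It comes after the two remnants, for
      which \<open>ea\<close> and \<open>eb\<close> are then the later edges that the cut ends
      need.\<close>
    let ?N = "nontrivial u p @ nontrivial y q @ [(?x, [(ea, w), (eb, y)])]"
    have lt: "late r h v" if "v \<in> walk_verts (u, p @ (e, y) # q)" for v
      using ear_not_late(1)[OF c that] False by auto
    have vs: "u \<in> walk_verts (u, p @ (e, y) # q)" "?x \<in> walk_verts (u, p @ (e, y) # q)"
       "y \<in> walk_verts (u, p @ (e, y) # q)" "target y q \<in> walk_verts (u, p @ (e, y) # q)"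
      using target_in_verts[of u p] target_in_verts[of y q] by (auto simp: walk_verts_Pair)
    have fall: "falling r h k u (p @ (e, y) # q)" if "p \<noteq> [] \<or> q \<noteq> []"
      using ear_cases[OF c] False that by (auto simp: bridging_def)
    have "ear i r h (\<lambda>v. deg i (walk_edges q + {#ea, eb#}) v + k' v) (u, p)" if "p \<noteq> []"
      using ear_split(1,3)[OF c] that fall k' wv
      by (intro fallingI lt) (auto simp: walk_verts_Pair falling_def met_def ids)
    moreover have "ear i r (\<lambda>v. h v + deg i (walk_edges p) v)
        (\<lambda>v. deg i {#ea, eb#} v + k' v) (y, q)" if "q \<noteq> []"
      using ear_split(2,5)[OF c] that fall k' wv
      by (intro fallingI late_mono[OF lt]) (auto simp: walk_verts_Pair falling_def met_def ids)
    moreover have "ear i r (\<lambda>v. h v + deg i (walk_edges p + walk_edges q) v) k'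
       (?x, [(ea, w), (eb, y)])"
      using deg_walk_notin[of i u p w] deg_walk_notin[of i y q w] ear_split(3,5)[OF c] wv w ids ids'
      by (intro risingI)
        (auto simp: walk_verts_Pair intro: late_mono[OF lt[OF vs(2)]] late_mono[OF lt[OF vs(3)]])
    ultimately have "staged (ear i r) i h ?N k'"
      by (simp add: add.assoc ids ids')
    then show ?thesis by (intro exI[of _ ?N]) simp
  qed
qed


text \<open>The half edge \<open>fa\<close> can stand alone as a falling ear from \<open>s\<close>
  to \<open>w\<close> if \<open>s\<close> has a later edge, possibly on the rest of this ear.
  Otherwise only the part from \<open>w\<close> on is built, and \<open>fa\<close> is left over; the
  facts about \<open>s\<close> serve to place it earlier.\<close>

lemma pinch_last_end:
  assumes c: "ear i r h k (s, (f, q) # p)"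
    and type: "rising r h s ((f, q) # p) \<or> p = [] \<and> late r h s \<and> late r h q \<and> late r k q"
    and ids: "i fa = Upair s w" "i fb = Upair q w"
    and w: "w \<noteq> r" "w \<notin> walk_verts (s, (f, q) # p)"
    and h': "\<And>v. v \<noteq> w \<Longrightarrow> h' v = h v" "h' w \<ge> 2"
  shows "(\<exists>N. staged (ear i r) i h' N k \<and>
      add_mset f (edges_of N) = walk_edges ((f, q) # p) + {#fa, fb#}) \<or>
    s \<noteq> r \<and> h s \<ge> 2 \<and> k s = 0 \<and> deg i (walk_edges ((f, q) # p)) s = 1 \<and>
    (\<exists>N. staged (ear i r) i h' N k \<and>
      add_mset f (edges_of N) = walk_edges ((f, q) # p) + {#fb#})"
proof -
  have ids': "i fb = Upair w q" using ids by (simp add: Upair_inject)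
  have f: "i f = Upair s q" using earD[OF c] by simp
  have wv: "w \<noteq> s" "w \<noteq> q" "w \<notin> snd ` set p" "w \<noteq> target q p" "w \<notin> set (inner p)"
    using w(2) target_in_verts[of q p] inner_subset[of p] by (auto simp: walk_verts_Pair)
  have ls: "late r h s" using type by (auto simp: rising_def)
  \<comment> \<open>Stated for a general \<open>h2\<close>, because the ear from \<open>w\<close> is
    used both after \<open>fa\<close> and without it.\<close>
  have new: "ear i r h2 k (w, (fb, q) # p)"
    if h2: "\<And>v. v \<noteq> s \<Longrightarrow> v \<noteq> w \<Longrightarrow> h2 v = h v" "h2 w \<ge> 2" "h2 s \<ge> h s" for h2
    using type
  proof
    assume rise: "rising r h s ((f, q) # p)"
    have "h2 v \<ge> h v" if "v \<noteq> w" for v using h2(1)[of v] h2(3) that by (cases "v = s") auto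
    then have "h2 s \<ge> h s" "h2 (target q p) \<ge> h (target q p)" using wv by auto
    moreover have "x \<noteq> r \<and> h2 x = 0" if "x \<in> set (inner ((fb, q) # p))" for x
    proof -
      have "x \<in> set (inner ((f, q) # p))" using that by (simp split: if_splits)
      then have "h x = 0" "x \<noteq> r" "x \<noteq> s" "x \<noteq> w"
        using rise earD[OF c] wv by (auto simp: rising_def split: if_splits)
      then show ?thesis using h2(1) by simp
    qed
    ultimately show ?thesis
      using rise earD[OF c] ids' wv h2(2)
      by (intro risingI) (auto simp: rising_def late_def split: if_splits)
  next
    assume b: "p = [] \<and> late r h s \<and> late r h q \<and> late r k q"
    have "h2 q \<ge> h q" using h2 wv by (cases "q = s") auto
    then have "bridging r h2 k w ((fb, q) # p)"
      using b h2(2) by (auto simp: bridging_def late_def)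
    then show ?thesis using b ids' wv by (auto simp: ear.simps)
  qed
  show ?thesis
  proof (cases "met r (\<lambda>v. deg i (add_mset fb (walk_edges p)) v + k v) s")
    case True
    let ?N = "[(s, [(fa, w)]), (w, (fb, q) # p)]"
    have "ear i r h' (\<lambda>v. deg i (add_mset fb (walk_edges p)) v + k v) (s, [(fa, w)])"
      using True ls h' ids wv
      by (intro fallingI) (auto simp: walk_verts_Pair late_def met_def ids')
    moreover have "ear i r (\<lambda>v. h' v + deg i {#fa#} v) k (w, (fb, q) # p)"
      using h' wv ids by (intro new) auto
    ultimately have "staged (ear i r) i h' ?N k" by simp
    then show ?thesis by (intro disjI1 exI[of _ ?N]) simp
  next
    case False
    have "staged (ear i r) i h' [(w, (fb, q) # p)] k"
      using new[of h'] h' wv by simp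
    moreover have "s \<noteq> r" "h s \<ge> 2" "k s = 0" "deg i (walk_edges ((f, q) # p)) s = 1"
      using False ls wv f ids' by (auto simp: met_def late_def split: if_splits)
    ultimately show ?thesis by (intro disjI2) (auto intro!: exI[of _ "[(w, (fb, q) # p)]"])
  qed
qed

text \<open>The alternatives \<open>P s fb\<close> and \<open>P q fa\<close> are the obstruction to pinching the later edge in place:
  that end has no later edge, so the half edge at it has to be placed earlier.\<close>

lemma pinch_last:
  assumes c: "ear i r h k (u, p @ (f, q) # p')"
    and s: "s = target u p"
    and ids: "i fa = Upair s w" "i fb = Upair q w"
    and w: "w \<noteq> r" "w \<notin> walk_verts (u, p @ (f, q) # p')"
    and h': "\<And>v. v \<noteq> w \<Longrightarrow> h' v = h v" "h' w \<ge> 2"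
  defines "E \<equiv> walk_edges (p @ (f, q) # p')"
  defines "P \<equiv> \<lambda>s fb. s \<noteq> r \<and> h s \<ge> 2 \<and> k s = 0 \<and> deg i E s = 1 \<and>
    (\<exists>N. staged (ear i r) i h' N k \<and> add_mset f (edges_of N) = E + {#fb#})"
  shows "(\<exists>N. staged (ear i r) i h' N k \<and> add_mset f (edges_of N) = E + {#fa, fb#}) \<or>
    P s fb \<or> P q fa"
proof -
  have ids': "i fb = Upair w q" using ids by (simp add: Upair_inject)
  have wv: "w \<noteq> u" "w \<notin> snd ` set p" "w \<noteq> q" "w \<notin> snd ` set p'" "w \<noteq> s" "w \<noteq> target q p'"
      "w \<notin> set (inner p)" "w \<notin> set (inner p')"
    using w(2) target_in_verts[of u p] target_in_verts[of q p'] inner_subset[of p] inner_subset[of p']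
    by (auto simp: walk_verts_Pair s)
  have first: ?thesis if "p = []"
    "rising r h u (p @ (f, q) # p') \<or> p' = [] \<and> late r h s \<and> late r h q \<and> late r k q"
    using pinch_last_end[of i r h k s f q p' fa w fb h'] c that ids w h'
    unfolding E_def P_def s by auto
  have last: ?thesis if p': "p' = []"
    "rising r h u (p @ (f, q) # p') \<or> p = [] \<and> late r h s \<and> late r h q \<and> late r k s"
  proof -
    note flip = ear_flip[OF c]
    have "rising r h q ((f, s) # reversal u p) \<or>
       reversal u p = [] \<and> late r h q \<and> late r h s \<and> late r k s"
    proof (cases "p = []")
      case False
      then have "set (inner p) \<subseteq> snd ` set p" "s \<in> snd ` set p"
        using s by (auto simp: target_in inner_subset)
      then show ?thesis
        using p' s False by (auto simp: rising_def split: if_splits)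
    qed (use p' s in \<open>auto simp: rising_def\<close>)
    moreover have "ear i r h k (q, (f, s) # reversal u p)" "w \<notin> walk_verts (q, (f, s) # reversal u p)"
      using flip p' s w(2) by auto
    ultimately have "(\<exists>N. staged (ear i r) i h' N k \<and>
        add_mset f (edges_of N) = walk_edges ((f, s) # reversal u p) + {#fb, fa#}) \<or>
      q \<noteq> r \<and> h q \<ge> 2 \<and> k q = 0 \<and> deg i (walk_edges ((f, s) # reversal u p)) q = 1 \<and>
      (\<exists>N. staged (ear i r) i h' N k \<and>
        add_mset f (edges_of N) = walk_edges ((f, s) # reversal u p) + {#fa#})"
      using ids w(1) h' by (intro pinch_last_end)
    moreover have "walk_edges ((f, s) # reversal u p) = E" "E + {#fb, fa#} = E + {#fa, fb#}"
      using p' by (auto simp: E_def add_mset_commute)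
    ultimately show ?thesis unfolding P_def by metis
  qed
  consider "rising r h u (p @ (f, q) # p')" "p \<noteq> []" "p' \<noteq> []"
    | "rising r h u (p @ (f, q) # p')" "p = []"
    | "rising r h u (p @ (f, q) # p')" "p' = []"
    | "falling r h k u (p @ (f, q) # p')"
    | "bridging r h k u (p @ (f, q) # p')"
    using ear_cases[OF c] by metis
  then show ?thesis
  proof cases
    case 1
    \<comment> \<open>\<open>w\<close> is late by now, so it can be an end of two rising ears, one
      for each side of \<open>f\<close>.\<close>
    let ?N = "[(u, p @ [(fa, w)]), (w, (fb, q) # p')]"
    have new: "v \<noteq> r \<and> h' v = 0" if "v \<in> insert q (snd ` set p \<union> set (inner p'))" for v
    proof -
      have "v \<in> set (inner (p @ (f, q) # p'))" "v \<noteq> w" using that 1 wv by auto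
      then show ?thesis using 1(1) h'(1)[of v] unfolding rising_def by simp
    qed
    \<comment> \<open>The first of the two ears must leave the inner vertices of the second one
      new.\<close>
    have z: "deg i (walk_edges (p @ [(fa, w)])) v = 0" if "v \<in> insert q (set (inner p'))" for v
    proof -
      have "v \<noteq> u" "v \<notin> snd ` set p" "v \<noteq> w"
        using earD[OF c] 1(2,3) that wv by (auto simp: disjoint_iff)
      moreover have "walk i u (p @ [(fa, w)])" using earD[OF c] ids s by simp
      ultimately show ?thesis
        using deg_walk_notin[of i u "p @ [(fa, w)]" v] by (auto simp: walk_verts_Pair)
    qed
    have l: "late r h' u" "late r h' (target q p')" "late r h' w"
      using 1(1) h' wv unfolding rising_def late_def by auto
    have i1: "inner (p @ [(fa, w)]) = map snd p" "inner ((fb, q) # p') = q # inner p'"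
      "distinct (map snd p)" "distinct (q # inner p')"
      using earD(3)[OF c] 1(3) by auto
    have "ear i r h' (\<lambda>v. deg i (add_mset fb (walk_edges p')) v + k v) (u, p @ [(fa, w)])"
    proof (rule risingI)
      show "length (p @ [(fa, w)]) \<ge> 2" using 1(2) by (cases p) auto
      show "walk i u (p @ [(fa, w)])" using earD(2)[OF c] ids s by simp
      show "x \<noteq> r \<and> h' x = 0" if "x \<in> set (inner (p @ [(fa, w)]))" for x
        using that new[of x] unfolding i1 by auto
    qed (use l i1 in auto)
    moreover have "ear i r (\<lambda>v. h' v + deg i (walk_edges (p @ [(fa, w)])) v) k (w, (fb, q) # p')"
    proof (rule risingI)
      show "length ((fb, q) # p') \<ge> 2" using 1(3) by (cases p') auto
      show "walk i w ((fb, q) # p')" using earD(2)[OF c] ids' by simp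
      show "x \<noteq> r \<and> h' x + deg i (walk_edges (p @ [(fa, w)])) x = 0"
        if "x \<in> set (inner ((fb, q) # p'))" for x
        using that new[of x] z[of x] unfolding i1 by auto
      show "late r (\<lambda>v. h' v + deg i (walk_edges (p @ [(fa, w)])) v) w"
        by (rule late_mono[OF l(3)]) simp
      show "late r (\<lambda>v. h' v + deg i (walk_edges (p @ [(fa, w)])) v) (target w ((fb, q) # p'))"
        by (rule late_mono) (use l(2) in auto)
      show "distinct (inner ((fb, q) # p'))" unfolding i1 by (rule i1)
    qed
    ultimately have "staged (ear i r) i h' ?N k" by simp
    then show ?thesis unfolding E_def by (intro disjI1 exI[of _ ?N]) simp
  next
    case 4
    \<comment> \<open>Since \<open>w\<close> is late, subdividing \<open>f\<close> at it keeps the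
      ear falling.\<close>
    let ?N = "[(u, p @ (fa, w) # (fb, q) # p')]"
    have "late r h' v" if "v \<in> walk_verts (u, p @ (fa, w) # (fb, q) # p')" for v
    proof (cases "v = w")
      case True
      then show ?thesis using h' by (simp add: late_def)
    next
      case False
      then have "late r h v" using 4 that by (auto simp: falling_def walk_verts_Pair)
      then show ?thesis using h'(1)[OF False] by (simp add: late_def)
    qed
    then have "ear i r h' k (u, p @ (fa, w) # (fb, q) # p')"
      using 4 earD[OF c] ids ids' wv s
      by (intro fallingI) (auto simp: falling_def split: if_splits)
    then have "staged (ear i r) i h' ?N k" by simp
    then show ?thesis unfolding E_def by (intro disjI1 exI[of _ ?N]) simp
  next
    case 5
    then have "p = []" "p' = []" by (auto simp: bridging_def)
    with 5 s show ?thesis using first last by (auto simp: bridging_def)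
  qed (use first last in auto)
qed

text \<open>If \<open>s\<close> lies on an ear strictly between those of \<open>e\<close> and \<open>f\<close>, the half edge \<open>sw\<close> is placed just
  before that ear, except when the ear is falling and ends in \<open>s\<close>: then its end would have no later
  edge, so it is prolonged to \<open>w\<close> instead.\<close>

lemma attach_between_end:
  assumes c: "ear i r h k (u, p)" and fall: "falling r h k u p" and s: "target u p = s"
    and s': "s \<noteq> r" "k s = 1"
    and fa: "i fa = Upair s w"
    and w: "w \<noteq> r" "w \<notin> walk_verts (u, p)"
    and h': "\<And>v. v \<noteq> w \<Longrightarrow> h' v = h v" "h' w \<ge> 2"
    and k': "\<And>v. v \<noteq> w \<Longrightarrow> v \<noteq> s \<Longrightarrow> k' v = k v" "k' w \<ge> 1"
  shows "ear i r h' k' (u, p @ [(fa, w)])"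
proof -
  \<comment> \<open>A falling ear closed at \<open>s\<close> would need two later edges there, but
    \<open>k s = 1\<close>.\<close>
  have us: "u \<noteq> s" using fall s s' by (auto simp: falling_def late_def)
  have ne: "p \<noteq> []" using earD[OF c] by simp
  have sn: "snd ` set p = insert s (set (inner p))" using set_inner_Cons[OF ne, of u] s by simp
  have wv: "w \<noteq> u" "w \<noteq> s" "w \<notin> set (inner p)" using w sn by (auto simp: walk_verts_Pair)
  have "late r h' v" if "v \<in> walk_verts (u, p @ [(fa, w)])" for v
  proof (cases "v = w")
    case True
    then show ?thesis using h' by (simp add: late_def)
  next
    case False
    then have "late r h v" using fall that by (auto simp: falling_def walk_verts_Pair)
    then show ?thesis using h'(1)[OF False] by (simp add: late_def)
  qed
  moreover have "met r k' u" "met r k' w"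
    using fall us wv k' by (auto simp: falling_def met_def)
  ultimately show ?thesis
    using earD[OF c] us fa wv s map_snd_conv[OF ne, of u]
    by (intro fallingI) auto
qed

text \<open>In its use the single later edge at \<open>s\<close> is \<open>f\<close>, whose half
  \<open>fa\<close> is moved here; therefore \<open>k'\<close> is left free at
  \<open>s\<close>.\<close>

lemma attach_between:
  assumes c: "ear i r h k c" and s: "s \<in> walk_verts c" "s \<noteq> r" "k s = 1"
    and deg4: "h s + deg i (walk_edges (snd c)) s + k s \<ge> 4"
    and fa: "i fa = Upair s w"
    and w: "w \<noteq> r" "w \<notin> walk_verts c"
    and h': "\<And>v. v \<noteq> w \<Longrightarrow> h' v = h v" "h' w \<ge> 2"
    and k': "\<And>v. v \<noteq> w \<Longrightarrow> v \<noteq> s \<Longrightarrow> k' v = k v" "k' w \<ge> 1"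
  shows "\<exists>N. staged (ear i r) i h' N k' \<and> edges_of N = add_mset fa (walk_edges (snd c))"
proof -
  obtain u p where [simp]: "c = (u, p)" by (cases c)
  note c = c[simplified \<open>c = (u, p)\<close>]
  have ne: "p \<noteq> []" using earD[OF c] by simp
  \<comment> \<open>If \<open>s\<close> entered on this ear, its total degree would be 0 + 2 + 1,
    below four.\<close>
  have ls: "late r h s"
    by (rule ccontr) (use ear_not_late(3,4)[OF c, of s] s deg4 in auto)
  consider (ends) "falling r h k u p" "target u p = s" | (starts) "falling r h k u p" "u = s"
    | (other) "falling r h k u p \<longrightarrow> u \<noteq> s \<and> target u p \<noteq> s" by blast
  then show ?thesis
  proof cases
    case ends
    have "staged (ear i r) i h' [(u, p @ [(fa, w)])] k'"
      using attach_between_end[of i r h k u p s fa w h' k'] c ends s fa w h' k'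
      by auto
    then show ?thesis by (intro exI[of _ "[(u, p @ [(fa, w)])]"]) simp
  next
    case starts
    let ?p = "reversal u p"
    have "falling r h k (target u p) ?p" using starts by (auto simp: falling_def)
    then have "staged (ear i r) i h' [(target u p, ?p @ [(fa, w)])] k'"
      using attach_between_end[of i r h k "target u p" ?p s fa w h' k'] ear_reversal[OF c]
        starts s fa w h' k'
      by auto
    then show ?thesis by (intro exI[of _ "[(target u p, ?p @ [(fa, w)])]"]) simp
  next
    case other
    have vs: "walk_verts (u, p) = insert u (insert (target u p) (set (inner p)))"
      by (rule walk_verts_conv[OF ne])
    have wv: "w \<noteq> u" "w \<noteq> target u p" "w \<notin> set (inner p)" "w \<noteq> s"
      using w vs s by auto
    have sp: "deg i (walk_edges p) s > 0"
      using deg_walk_pos[of i u p s] earD[OF c] s by auto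
    \<comment> \<open>The ear itself follows and supplies the later edge that \<open>fa\<close>
      needs at \<open>s\<close>.\<close>
    have "ear i r h' (\<lambda>v. deg i (walk_edges p) v + k' v) (s, [(fa, w)])"
      using ls fa h' k' wv sp by (intro fallingI) (auto simp: walk_verts_Pair late_def met_def)
    moreover have "ear i r (\<lambda>v. h' v + inc (i fa) v) k' (u, p)"
    proof -
      have l: "late r (\<lambda>v. h' v + inc (i fa) v) v" if "late r h v" "v \<noteq> w" for v
        using that h'(1) by (auto simp: late_def)
      \<comment> \<open>\<open>s\<close> is not late in \<open>k\<close>, so the loss of a later
        edge at \<open>s\<close> does no harm.\<close>
      have lk: "late r k' v" if "late r k v" "v \<noteq> w" for v
        using that k'(1)[of v] s by (cases "v = s") (auto simp: late_def)
      consider "rising r h u p" | "falling r h k u p" | "bridging r h k u p"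
        using ear_cases[OF c] by metis
      then show ?thesis
      proof cases
        case 1
        then have "s \<notin> set (inner p)" using ls by (auto simp: rising_def late_def)
        then show ?thesis using 1 earD[OF c] l wv h' fa
          by (intro risingI) (auto simp: rising_def)
      next
        case 2
        have "met r k' v" if "met r k v" "v \<noteq> w" "v \<noteq> s" for v
          using that k'(1)[of v] by (auto simp: met_def)
        then show ?thesis using 2 earD[OF c] l lk wv other
          by (intro fallingI) (auto simp: falling_def vs)
      next
        case 3
        then have "bridging r (\<lambda>v. h' v + inc (i fa) v) k' u p"
          using l lk wv by (auto simp: bridging_def)
        then show ?thesis using earD[OF c] by (auto simp: ear.simps)
      qed
    qed
    ultimately have "staged (ear i r) i h' [(s, [(fa, w)]), (u, p)] k'"
      by simp
    then show ?thesis
      by (intro exI[of _ "[(s, [(fa, w)]), (u, p)]"]) simp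
  qed
qed

text \<open>If no ear strictly between contains \<open>s\<close>, three of the edges of \<open>w\<close> are placed at the ear of \<open>e\<close>.\<close>

lemma pinch_three_up:
  assumes c: "ear i r h k (u, p @ (e, y) # q)" and x: "x = target u p"
    and up: "rising r h u (p @ (e, y) # q)" "q \<noteq> []"
    and ids: "i ea = Upair x w" "i eb = Upair y w" "i fa = Upair s w"
    and s: "s \<noteq> r" "late r h s"
    and w: "w \<noteq> r" "w \<noteq> s" "w \<notin> walk_verts (u, p @ (e, y) # q)" "h w = 0"
  shows "\<exists>N. staged (ear i r) i h N k' \<and>
    add_mset e (edges_of N) = walk_edges (p @ (e, y) # q) + {#ea, eb, fa#}"
proof -
  have ids': "i eb = Upair w y" "i fa = Upair w s" using ids by (simp_all add: Upair_inject)
  have wv: "w \<noteq> u" "w \<notin> snd ` set p" "w \<noteq> y" "w \<notin> snd ` set q" "w \<noteq> x" "w \<noteq> target y q"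
    using w(3) target_in_verts[of u p] target_in_verts[of y q] by (auto simp: walk_verts_Pair x)
  have wq: "w \<notin> set (inner q)" using wv inner_subset[of q] by auto
  \<comment> \<open>The ear is cut at \<open>e\<close>: its first part now runs through
    \<open>w\<close> to the late vertex \<open>s\<close>. After that \<open>w\<close> has two
    earlier edges and can start a second rising ear with the rest.\<close>
  let ?p = "p @ [(ea, w), (fa, s)]"
  let ?N = "[(u, ?p), (w, (eb, y) # q)]"
  have new: "v \<noteq> r \<and> h v = 0" if "v \<in> snd ` set p \<union> insert y (set (inner q))" for v
    using up that by (auto simp: rising_def)
  have sn: "s \<notin> snd ` set p \<union> insert y (set (inner q))"
    using new[of s] s by (auto simp: late_def)
  have walk1: "walk i u ?p" using earD[OF c] ids ids' x by auto
  have 1: "ear i r h (\<lambda>v. deg i (add_mset eb (walk_edges q)) v + k' v) (u, ?p)"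
    using up earD[OF c] walk1 wv w s new
    by (intro risingI) (auto simp: rising_def)
  have "deg i (walk_edges ?p) v = 0" if "v \<in> insert y (set (inner q))" for v
  proof -
    have "v \<noteq> u" "v \<notin> snd ` set p" "v \<noteq> w" "v \<noteq> s" using up earD[OF c] that wv wq sn by auto
    then show ?thesis
      using deg_walk_notin[OF walk1, of v] by (auto simp: walk_verts_Pair)
  qed
  moreover have "deg i (walk_edges ?p) w \<ge> 2" using ids by simp
  ultimately have 2: "ear i r (\<lambda>v. h v + deg i (walk_edges ?p) v) k' (w, (eb, y) # q)"
    using up earD[OF c] ids' new new[of r] w
    by (intro risingI) (auto simp: rising_def late_def Suc_le_eq simp del: walk_edges_simps)
  have "staged (ear i r) i h ?N k'" using 1 2 by simp
  then show ?thesis by (intro exI[of _ ?N]) simp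
qed

text \<open>\<open>w\<close> enters between \<open>x\<close> and \<open>s\<close>, and the second
  part of the falling ear then starts at \<open>w\<close>. Its other end must not be
  \<open>s\<close>, where no later edge need remain.\<close>

lemma pinch_three_down:
  assumes c: "ear i r h k (u, p @ (e, y) # q)" and x: "x = target u p"
    and down: "falling r h k u (p @ (e, y) # q)" "target y q \<noteq> s"
    and ids: "i ea = Upair x w" "i eb = Upair y w" "i fa = Upair s w"
    and s: "s \<noteq> r" "late r h s"
    and w: "w \<noteq> r" "w \<noteq> s" "w \<notin> walk_verts (u, p @ (e, y) # q)" "h w = 0"
    and k': "\<And>v. v \<noteq> w \<Longrightarrow> v \<noteq> s \<Longrightarrow> k' v = k v" "k' w \<ge> 1"
  shows "\<exists>N. staged (ear i r) i h N k' \<and>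
    add_mset e (edges_of N) = walk_edges (p @ (e, y) # q) + {#ea, eb, fa#}"
proof -
  have ids': "i eb = Upair w y" "i fa = Upair w s" using ids by (simp_all add: Upair_inject)
  have wv: "w \<noteq> u" "w \<notin> snd ` set p" "w \<noteq> y" "w \<notin> snd ` set q" "w \<noteq> x" "w \<noteq> target y q"
    using w(3) target_in_verts[of u p] target_in_verts[of y q] by (auto simp: walk_verts_Pair x)
  let ?N = "nontrivial u p @ [(x, [(ea, w), (fa, s)]), (w, (eb, y) # q)]"
  have lt: "late r h v" if "v \<in> walk_verts (u, p @ (e, y) # q)" for v
    using down that by (auto simp: falling_def)
  have xv: "x \<in> walk_verts (u, p @ (e, y) # q)"
    using target_in_verts[of u p] by (auto simp: walk_verts_Pair x)
  \<comment> \<open>In case \<open>u = s\<close> the later edge required at \<open>u\<close> is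
    \<open>fa\<close>.\<close>
  have 1: "ear i r h (\<lambda>v. deg i ({#ea, fa, eb#} + walk_edges q) v + k' v) (u, p)" if "p \<noteq> []"
    using ear_split(1,3)[OF c] that down k' wv x
    by (intro fallingI lt) (auto simp: walk_verts_Pair falling_def met_def ids)
  have 2: "ear i r (\<lambda>v. h v + deg i (walk_edges p) v)
     (\<lambda>v. deg i (add_mset eb (walk_edges q)) v + k' v) (x, [(ea, w), (fa, s)])"
    using deg_walk_notin[of i u p w] ear_split(3)[OF c] wv w ids ids' s
    by (intro risingI)
      (auto simp: walk_verts_Pair intro: late_mono[OF s(2)] late_mono[OF lt[OF xv]])
  have 3: "ear i r (\<lambda>v. h v + (deg i (walk_edges p) v + deg i {#ea, fa#} v)) k' (w, (eb, y) # q)"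
    if l: "\<And>v. v \<in> walk_verts (w, (eb, y) # q) \<Longrightarrow>
      late r (\<lambda>v. h v + (deg i (walk_edges p) v + deg i {#ea, fa#} v)) v"
    using earD[OF c] that down k' wv x w ids' inner_subset[of q]
    by (intro fallingI l) (auto simp: falling_def met_def split: if_splits)
  have "late r (\<lambda>v. h v + (deg i (walk_edges p) v + deg i {#ea, fa#} v)) v"
    if "v \<in> walk_verts (w, (eb, y) # q)" for v
  proof (cases "v = w")
    case True
    then show ?thesis using ids by (simp add: late_def)
  next
    case False
    then show ?thesis using that by (intro late_mono[OF lt[of v]]) (auto simp: walk_verts_Pair)
  qed
  from 3[OF this] have "staged (ear i r) i h ?N k'"
    using 1 2 by (simp add: ac_simps)
  then show ?thesis by (intro exI[of _ ?N]) (simp add: add_mset_commute)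
qed

text \<open>From \<open>late r k y\<close> and \<open>k s = 1\<close> it follows that
  \<open>y\<close> is not \<open>s\<close>. So \<open>y\<close> stays late in \<open>k'\<close>, and
  \<open>eb\<close> can bridge once \<open>w\<close> has entered between \<open>x\<close> and
  \<open>s\<close>.\<close>

lemma pinch_three_bridge:
  assumes c: "ear i r h k (x, [(e, y)])" and lk: "late r h x" "late r h y" "late r k y" "k s = 1"
    and ids: "i ea = Upair x w" "i eb = Upair y w" "i fa = Upair s w"
    and s: "s \<noteq> r" "late r h s"
    and w: "w \<noteq> r" "w \<noteq> s" "w \<notin> walk_verts (x, [(e, y)])" "h w = 0"
    and k': "\<And>v. v \<noteq> w \<Longrightarrow> v \<noteq> s \<Longrightarrow> k' v = k v" "k' w \<ge> 1"
  shows "\<exists>N. staged (ear i r) i h N k' \<and> add_mset e (edges_of N) = {#e, ea, eb, fa#}"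
proof -
  have ids': "i eb = Upair w y" "i fa = Upair w s" using ids by (simp_all add: Upair_inject)
  have wv: "w \<noteq> x" "w \<noteq> y" using w(3) by (auto simp: walk_verts_Pair)
  let ?N = "[(x, [(ea, w), (fa, s)]), (w, [(eb, y)])]"
  have "late r k' y"
    using lk(3,4) k'(1)[of y] wv by (cases "y = s") (auto simp: late_def s)
  then have "bridging r (\<lambda>v. h v + deg i {#ea, fa#} v) k' w [(eb, y)]"
    using lk ids wv by (auto simp: bridging_def late_def)
  then have "ear i r (\<lambda>v. h v + deg i {#ea, fa#} v) k' (w, [(eb, y)])"
    using ids' wv by (simp add: ear.simps)
  moreover have "ear i r h (\<lambda>v. deg i {#eb#} v + k' v) (x, [(ea, w), (fa, s)])"
    using lk s w ids ids' wv by (intro risingI) auto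
  ultimately have "staged (ear i r) i h ?N k'" by simp
  then show ?thesis by (intro exI[of _ ?N]) simp
qed

lemma rising_reversal: "rising r h u p \<Longrightarrow> rising r h (target u p) (reversal u p)"
  by (auto simp: rising_def)

lemma falling_reversal: "falling r h k u p \<Longrightarrow> falling r h k (target u p) (reversal u p)"
  by (auto simp: falling_def)

text \<open>Reversing the ear, if necessary, secures the side conditions: a rising ear has an edge
  besides \<open>e\<close>, and a falling ear cannot have \<open>s\<close> at both ends because
  \<open>k s = 1\<close>.\<close>

lemma pinch_three:
  assumes c: "ear i r h k (u, p @ (e, y) # q)" and x: "x = target u p"
    and s: "s \<noteq> r" "k s = 1" "h s + deg i (walk_edges (p @ (e, y) # q)) s + k s \<ge> 4"
    and ids: "i ea = Upair x w" "i eb = Upair y w" "i fa = Upair s w"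
    and w: "w \<noteq> r" "w \<noteq> s" "w \<notin> walk_verts (u, p @ (e, y) # q)" "h w = 0"
    and k': "\<And>v. v \<noteq> w \<Longrightarrow> v \<noteq> s \<Longrightarrow> k' v = k v" "k' w \<ge> 1"
  shows "\<exists>N. staged (ear i r) i h N k' \<and>
    add_mset e (edges_of N) = walk_edges (p @ (e, y) # q) + {#ea, eb, fa#}"
proof -
  \<comment> \<open>Entering on this very ear would give \<open>s\<close> the total degree 0 + 2 +
    1; off the ear, at least three of its edges are earlier.\<close>
  have ls: "late r h s"
  proof (cases "s \<in> walk_verts (u, p @ (e, y) # q)")
    case True
    show ?thesis by (rule ccontr) (use ear_not_late(3,4)[OF c True] s in auto)
  next
    case False
    then have "deg i (walk_edges (p @ (e, y) # q)) s = 0"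
      by (rule deg_walk_notin[OF earD(2)[OF c]])
    then show ?thesis using s by (auto simp: late_def)
  qed
  let ?c' = "reversal y q @ (e, x) # reversal u p"
  note flip = ear_flip[OF c, folded x]
  have y': "y = target (target y q) (reversal y q)" by simp
  have goal: "{#eb, ea, fa#} = {#ea, eb, fa#}" by (simp add: add_mset_commute)
  show ?thesis
    using c
  proof (cases rule: ear_cases)
    case rising
    show ?thesis
    proof (cases "q = []")
      case False
      show ?thesis by (rule pinch_three_up[OF c x rising False ids s(1) ls w])
    next
      case True
      then have ne: "reversal u p \<noteq> []" using rising by (auto simp: rising_def)
      have "rising r h (target y q) ?c'"
        using rising_reversal[OF rising] x by simp
      from pinch_three_up[OF flip(1) y' this ne ids(2) ids(1) ids(3) s(1) ls w(1,2) _ w(4), of k']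
      show ?thesis using w(3) flip by (simp add: goal add_mset_commute union_commute)
    qed
  next
    case falling
    show ?thesis
    proof (cases "target y q = s")
      case False
      show ?thesis by (rule pinch_three_down[OF c x falling False ids s(1) ls w k'])
    next
      case True
      then have ne: "target x (reversal u p) \<noteq> s"
        using falling s x by (auto simp: falling_def late_def)
      have "falling r h k (target y q) ?c'"
        using falling_reversal[OF falling] x by simp
      from pinch_three_down[OF flip(1) y' this ne ids(2) ids(1) ids(3) s(1) ls w(1,2) _ w(4) k']
      show ?thesis using w(3) flip by (simp add: goal add_mset_commute union_commute)
    qed
  next
    case bridging
    then have pq: "p = []" "q = []" "x = u" by (auto simp: bridging_def x)
    have l: "late r h x" "late r h y" "late r k x \<or> late r k y"
      using bridging pq by (auto simp: bridging_def)
    from l(3) show ?thesis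
    proof
      assume "late r k y"
      then show ?thesis
        using pinch_three_bridge[of i r h k x e y s ea w eb fa k'] c pq l s ls ids w k' by auto
    next
      assume "late r k x"
      then show ?thesis
        using pinch_three_bridge[of i r h k y e x s eb w ea fa k'] flip pq l s ls ids w k'
        by (auto simp: goal add_mset_commute)
    qed
  qed
qed

text \<open>The main ear takes the short cut from \<open>target u p\<close> through \<open>w\<close>
  to \<open>q\<close>, so that \<open>w\<close> enters on it; the bypassed part is then closed up at
  \<open>w\<close> to a second rising ear.\<close>

lemma pinch_same_up:
  assumes c: "ear i r h k (u, p @ (e, y) # p' @ (f, q) # p'')"
    and up: "rising r h u (p @ (e, y) # p' @ (f, q) # p'')"
    and ids: "i ea = Upair (target u p) w" "i eb = Upair y w"
      "i fa = Upair (target y p') w" "i fb = Upair q w"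
    and w: "w \<noteq> r" "w \<notin> walk_verts (u, p @ (e, y) # p' @ (f, q) # p'')" "h w = 0"
  shows "\<exists>N. staged (ear i r) i h N k' \<and> edges_of N + {#e, f#} =
    walk_edges (p @ (e, y) # p' @ (f, q) # p'') + {#ea, eb, fa, fb#}"
proof -
  have ids': "i fb = Upair w q" "i eb = Upair w y" using ids by (simp_all add: Upair_inject)
  let ?c1 = "p @ (ea, w) # (fb, q) # p''" and ?c2 = "(eb, y) # p' @ [(fa, w)]"
  let ?N = "[(u, ?c1), (w, ?c2)]"
  have inn: "inner (p @ (e, y) # p' @ (f, q) # p'') = map snd p @ y # map snd p' @ inner ((f, q) # p'')"
    "inner ?c1 = map snd p @ w # inner ((f, q) # p'')" "inner ?c2 = y # map snd p'"
    by auto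
  have wv: "w \<noteq> u" "w \<notin> snd ` set p" "w \<noteq> y" "w \<notin> snd ` set p'" "w \<noteq> q" "w \<notin> snd ` set p''"
      "w \<noteq> target q p''" "w \<notin> set (inner ((f, q) # p''))"
    using w(2) target_in_verts[of q p''] inner_subset[of p'']
    by (auto simp: walk_verts_Pair split: if_splits)
  have dist: "distinct (map snd p @ y # map snd p' @ inner ((f, q) # p''))"
    and un: "u \<notin> set (map snd p @ y # map snd p' @ inner ((f, q) # p''))"
    and tn: "target q p'' \<notin> set (map snd p @ y # map snd p' @ inner ((f, q) # p''))"
    using earD(3-5)[OF c] unfolding inn by auto
  have new: "v \<noteq> r \<and> h v = 0"
    if "v \<in> set (map snd p @ y # map snd p' @ inner ((f, q) # p''))" for v
    using up that unfolding rising_def inn by blast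
  have walk1: "walk i u ?c1" using earD(2)[OF c] ids ids' by auto
  have 1: "ear i r h (\<lambda>v. deg i (walk_edges ?c2) v + k' v) (u, ?c1)"
  proof (rule risingI[OF _ walk1])
    show "distinct (inner ?c1)" using dist wv unfolding inn by auto
    show "x \<noteq> r \<and> h x = 0" if "x \<in> set (inner ?c1)" for x
      using that new[of x] w unfolding inn by auto
  qed (use up in \<open>auto simp: rising_def\<close>)
  have z: "deg i (walk_edges ?c1) v = 0" if "v \<in> insert y (snd ` set p')" for v
  proof (rule deg_walk_notin[OF walk1])
    have "v \<noteq> u" "v \<notin> snd ` set p" "v \<noteq> w" "v \<noteq> target q p''" "v \<notin> set (inner ((f, q) # p''))"
      using that dist un tn wv by auto
    moreover have "insert q (snd ` set p'') = insert (target q p'') (set (inner ((f, q) # p'')))"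
      using set_inner_Cons[of "(f, q) # p''" u] by simp
    ultimately show "v \<notin> walk_verts (u, ?c1)" by (auto simp: walk_verts_Pair)
  qed
  have "inc (i ea) w + inc (i fb) w \<ge> 2" using ids by simp
  then have lw: "late r (\<lambda>v. h v + deg i (walk_edges ?c1) v) w" by (simp add: late_def)
  have 2: "ear i r (\<lambda>v. h v + deg i (walk_edges ?c1) v) k' (w, ?c2)"
  proof (rule risingI)
    show "walk i w ?c2" using earD(2)[OF c] ids ids' by auto
    show "distinct (inner ?c2)" using dist unfolding inn by auto
    show "x \<noteq> r \<and> h x + deg i (walk_edges ?c1) x = 0" if "x \<in> set (inner ?c2)" for x
      using that new[of x] z[of x] unfolding inn by auto
  qed (use lw in auto)
  have "staged (ear i r) i h ?N k'" using 1 2 by simp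
  then show ?thesis by (intro exI[of _ ?N]) simp
qed

text \<open>Here all vertices are late already. The bypassed part comes first, as a falling ear;
  then \<open>w\<close> enters between \<open>y\<close> and \<open>target y p'\<close>; the short
  cut through \<open>w\<close> comes last and is still falling.\<close>

lemma pinch_same_down:
  assumes c: "ear i r h k (u, p @ (e, y) # p' @ (f, q) # p'')"
    and down: "falling r h k u (p @ (e, y) # p' @ (f, q) # p'')"
    and ids: "i ea = Upair (target u p) w" "i eb = Upair y w"
      "i fa = Upair (target y p') w" "i fb = Upair q w"
    and w: "w \<noteq> r" "w \<notin> walk_verts (u, p @ (e, y) # p' @ (f, q) # p'')" "h w = 0"
    and k': "\<And>v. v \<noteq> w \<Longrightarrow> k' v = k v"
  shows "\<exists>N. staged (ear i r) i h N k' \<and> edges_of N + {#e, f#} =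
    walk_edges (p @ (e, y) # p' @ (f, q) # p'') + {#ea, eb, fa, fb#}"
proof -
  let ?s = "target y p'"
  have ids': "i fb = Upair w q" "i fa = Upair w ?s" using ids by (simp_all add: Upair_inject)
  let ?c1 = "[(eb, w), (fa, ?s)]" and ?c2 = "p @ (ea, w) # (fb, q) # p''"
  let ?N = "nontrivial y p' @ [(y, ?c1), (u, ?c2)]"
  have inn: "inner (p @ (e, y) # p' @ (f, q) # p'') = map snd p @ y # map snd p' @ inner ((f, q) # p'')"
    "inner ?c2 = map snd p @ w # inner ((f, q) # p'')"
    by auto
  have wv: "w \<noteq> u" "w \<notin> snd ` set p" "w \<noteq> y" "w \<notin> snd ` set p'" "w \<noteq> q" "w \<notin> snd ` set p''"
      "w \<noteq> target q p''" "w \<notin> set (inner ((f, q) # p''))" "w \<noteq> ?s"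
    using w(2) target_in_verts[of q p''] inner_subset[of p''] target_in_verts[of y p']
    by (auto simp: walk_verts_Pair split: if_splits)
  have dist: "distinct (map snd p @ y # map snd p' @ inner ((f, q) # p''))"
    and un: "u \<notin> set (map snd p @ y # map snd p' @ inner ((f, q) # p''))"
    and tn: "target q p'' \<notin> set (map snd p @ y # map snd p' @ inner ((f, q) # p''))"
    using earD(3-5)[OF c] unfolding inn by auto
  have lt: "late r h v" if "v \<in> walk_verts (u, p @ (e, y) # p' @ (f, q) # p'')" for v
    using down that by (auto simp: falling_def)
  have lv: "late r h y" "late r h ?s"
    using target_in_verts[of y p'] lt[of y] lt[of ?s] by (auto simp: walk_verts_Pair)
  have "y \<notin> snd ` set p'" using dist by auto
  then have "y \<noteq> ?s" if "p' \<noteq> []" using target_in[OF that, of y] by metis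
  then have 1: "ear i r h (\<lambda>v. deg i (walk_edges ?c1 + walk_edges ?c2) v + k' v) (y, p')"
    if "p' \<noteq> []"
    using map_snd_conv[OF that, of y] that earD(2)[OF c] dist
    by (intro fallingI lt) (auto simp: walk_verts_Pair met_def ids)
  have "deg i (walk_edges p') w = 0"
    using earD(2)[OF c] wv by (intro deg_walk_notin[of i y]) (auto simp: walk_verts_Pair)
  then have 2: "ear i r (\<lambda>v. h v + deg i (walk_edges p') v)
      (\<lambda>v. deg i (walk_edges ?c2) v + k' v) (y, ?c1)"
    using ids ids' wv w by (intro risingI) (auto intro: late_mono[OF lv(1)] late_mono[OF lv(2)])
  let ?h = "\<lambda>v. h v + deg i (walk_edges p' + walk_edges ?c1) v"
  have 3: "ear i r ?h k' (u, ?c2)"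
  proof (rule fallingI)
    show "walk i u ?c2" using earD(2)[OF c] ids ids' by auto
    show "distinct (inner ?c2)" using dist wv unfolding inn by auto
    show "u \<notin> set (inner ?c2)" using un wv unfolding inn by auto
    show "target u ?c2 \<notin> set (inner ?c2)" using tn wv unfolding inn by auto
    show "late r ?h v" if "v \<in> walk_verts (u, ?c2)" for v
    proof (cases "v = w")
      case True
      then show ?thesis using ids by (simp add: late_def)
    next
      case False
      then show ?thesis
        using that by (intro late_mono[OF lt[of v]]) (auto simp: walk_verts_Pair)
    qed
  qed (use down wv k' in \<open>auto simp: falling_def met_def late_def\<close>)
  have "staged (ear i r) i h ?N k'" using 1 2 3 by (simp add: ac_simps)
  then show ?thesis by (intro exI[of _ ?N]) simp
qed

section \<open>Assembling the replaced ears into a whole decomposition\<close>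

lemma deg_edges_of_notin:
  assumes "staged (ear i r) i h cs k" "\<And>c. c \<in> set cs \<Longrightarrow> v \<notin> walk_verts c"
  shows "deg i (edges_of cs) v = 0"
  using assms
proof (induction cs arbitrary: h)
  case (Cons c cs)
  obtain u p where c: "c = (u, p)" by (cases c)
  have "walk i u p" using Cons.prems(1) earD(2) unfolding c by fastforce
  then have "deg i (walk_edges p) v = 0"
    using Cons.prems(2)[of c] by (intro deg_walk_notin) (auto simp: c)
  moreover have "deg i (edges_of cs) v = 0"
    using Cons.prems by (intro Cons.IH) auto
  ultimately show ?case by (simp add: c)
qed simp

text \<open>The ear may run through \<open>e\<close> in either direction; \<open>ea'\<close> and
  \<open>eb'\<close> are the two half edges named in the order of the ear.\<close>

lemma ear_edge_split:
  assumes "ear i r h k c" "e \<in># walk_edges (snd c)" "i e = Upair x y"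
    and "i ea = Upair x w" "i eb = Upair y w"
  obtains u p y' q ea' eb' where "c = (u, p @ (e, y') # q)" "i e = Upair (target u p) y'"
    "i ea' = Upair (target u p) w" "i eb' = Upair y' w"
    "target u p = x \<and> y' = y \<and> ea' = ea \<and> eb' = eb \<or>
     target u p = y \<and> y' = x \<and> ea' = eb \<and> eb' = ea"
proof -
  obtain u p0 where c: "c = (u, p0)" by (cases c)
  then obtain y' where "(e, y') \<in> set p0" using assms(2) by (auto simp: walk_edges_def)
  then obtain p q where p0: "p0 = p @ (e, y') # q" by (meson split_list)
  have "i e = Upair (target u p) y'" using earD(2)[of i r h k u p0] assms(1) c p0 by auto
  moreover from this have "target u p = x \<and> y' = y \<or> target u p = y \<and> y' = x"
    using assms(3) by (auto simp: Upair_inject)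
  ultimately show ?thesis
    using that[of u p y' q ea eb] that[of u p y' q eb ea] c p0 assms(4,5) by auto
qed

lemma target_split_in_verts: "target u p \<in> walk_verts (u, p @ q)"
  using target_in_verts[of u p] by (auto simp: walk_verts_Pair)

text \<open>The obstructed case: \<open>M\<close> replaces \<open>d\<close> but lacks
  \<open>fa\<close>. The work lies in checking that the untouched ears see the same degrees as
  before.\<close>

lemma pinch_apart_last:
  assumes st: "staged (ear i r) i (\<lambda>_. 0) (A @ (u, p @ (e, y) # q) # B @ d # C) (\<lambda>_. 0)"
    and x: "x = target u p"
    and ids: "i ea = Upair x w" "i eb = Upair y w" "i f = Upair s t" "i fa = Upair s w" "i fb = Upair t w"
    and w: "w \<noteq> r" "w \<noteq> s" "w \<noteq> t" "\<And>c. c \<in> set (A @ (u, p @ (e, y) # q) # B @ d # C) \<Longrightarrow> w \<notin> walk_verts c"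
    and s: "s \<noteq> r" "deg i (edges_of C) s = 0" "deg i (walk_edges (snd d)) s = 1"
    and deg4: "deg i (edges_of (A @ (u, p @ (e, y) # q) # B @ d # C)) s \<ge> 4"
    and M: "staged (ear i r) i (\<lambda>v. deg i (edges_of (A @ (u, p @ (e, y) # q) # B)) v + (if v = w then 2 else 0)) M
       (deg i (edges_of C))"
      "add_mset f (edges_of M) = walk_edges (snd d) + {#fb#}"
  shows "\<exists>cs'. staged (ear i r) i (\<lambda>_. 0) cs' (\<lambda>_. 0) \<and> edges_of cs' + {#e, f#} =
    edges_of (A @ (u, p @ (e, y) # q) # B @ d # C) + {#ea, eb, fa, fb#}"
proof -
  let ?p = "p @ (e, y) # q"
  have c: "ear i r (deg i (edges_of A)) (\<lambda>v. deg i (edges_of (B @ d # C)) v) (u, ?p)"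
    and stA: "staged (ear i r) i (\<lambda>_. 0) A (deg i (edges_of ((u, ?p) # B @ d # C)))"
    and stB: "staged (ear i r) i (deg i (edges_of (A @ [(u, ?p)]))) B (deg i (edges_of (d # C)))"
    and stC: "staged (ear i r) i (deg i (edges_of (A @ (u, ?p) # B @ [d]))) C (\<lambda>_. 0)"
    and d: "ear i r (deg i (edges_of (A @ (u, ?p) # B))) (deg i (edges_of C)) d"
    using st by (simp_all add: ac_simps)
  have w0: "deg i (edges_of A) w = 0" "deg i (edges_of B) w = 0" "deg i (edges_of C) w = 0"
    "deg i (walk_edges ?p) w = 0" "deg i (walk_edges (snd d)) w = 0"
    using deg_edges_of_notin[OF st] deg_edges_of_notin[OF stA] deg_edges_of_notin[OF stB]
      deg_edges_of_notin[OF stC] w(4) by auto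
  have cv: "w \<noteq> x" "w \<noteq> y" "w \<notin> walk_verts (u, ?p)"
    using w(4)[of "(u, ?p)"] target_split_in_verts[of u p "(e, y) # q"]
    by (auto simp: x walk_verts_Pair)
  \<comment> \<open>Compared with \<open>d\<close>, one edge end is lost at \<open>s\<close>, and
    \<open>w\<close> gains only \<open>fb\<close>.\<close>
  have dM: "deg i (edges_of M) v + (if v = s then 1 else 0) =
      deg i (walk_edges (snd d)) v + (if v = w then 1 else 0)" for v
    using arg_cong[OF M(2), of "\<lambda>X. deg i X v"] ids by auto
  have ie: "i e = Upair x y" using earD(2)[OF c] x by simp
  show ?thesis
  proof (cases "\<exists>b \<in> set B. s \<in> walk_verts b")
    case True
    \<comment> \<open>The last such ear is taken, so that no ear of \<open>B2\<close> notices the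
      change of degree at \<open>s\<close>.\<close>
    then obtain B1 b B2 where B: "B = B1 @ b # B2" and b: "s \<in> walk_verts b"
      and B2: "\<And>c. c \<in> set B2 \<Longrightarrow> s \<notin> walk_verts c"
      using split_list_last_prop[of B "\<lambda>b. s \<in> walk_verts b"] by metis
    have be: "ear i r (deg i (edges_of (A @ (u, ?p) # B1))) (deg i (edges_of (B2 @ d # C))) b"
      and stB1: "staged (ear i r) i (deg i (edges_of (A @ [(u, ?p)]))) B1
        (deg i (edges_of (b # B2 @ d # C)))"
      and stB2: "staged (ear i r) i (deg i (edges_of (A @ (u, ?p) # B1 @ [b]))) B2
        (deg i (edges_of (d # C)))"
      using stB unfolding B by (simp_all add: ac_simps)
    have s0: "deg i (edges_of B2) s = 0" by (rule deg_edges_of_notin[OF stB2 B2])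
    obtain Nb where Nb: "staged (ear i r) i
        (\<lambda>v. deg i (edges_of (A @ (u, ?p) # B1)) v + (if v = w then 2 else 0)) Nb
        (deg i (edges_of (B2 @ M @ C)))"
      "edges_of Nb = add_mset fa (walk_edges (snd b))"
    proof -
      have "\<exists>N. staged (ear i r) i
          (\<lambda>v. deg i (edges_of (A @ (u, ?p) # B1)) v + (if v = w then 2 else 0)) N
          (deg i (edges_of (B2 @ M @ C))) \<and> edges_of N = add_mset fa (walk_edges (snd b))"
      proof (rule attach_between[OF be b s(1) _ _ ids(4) w(1)])
        show "deg i (edges_of (B2 @ M @ C)) v = deg i (edges_of (B2 @ d # C)) v"
          if "v \<noteq> w" "v \<noteq> s" for v
          using dM[of v] that by simp
        show "1 \<le> deg i (edges_of (B2 @ M @ C)) w" using dM[of w] w by simp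
      qed (use w s s0 deg4 B in auto)
      then show ?thesis using that by blast
    qed
    have dNb: "deg i (edges_of Nb) v = deg i (walk_edges (snd b)) v + (if v = s then 1 else 0)
      + (if v = w then 1 else 0)" for v
      using Nb(2) ids by simp
    obtain N where N: "staged (ear i r) i (deg i (edges_of A)) N
        (deg i (edges_of (B1 @ Nb @ B2 @ M @ C)))"
      "add_mset e (edges_of N) = walk_edges ?p + {#ea, eb#}"
    proof -
      have "deg i (edges_of (B1 @ Nb @ B2 @ M @ C)) v = deg i (edges_of (B @ d # C)) v"
        if "v \<noteq> w" for v
        using dM[of v] dNb[of v] that by (simp add: B)
      moreover have "deg i (edges_of (B1 @ Nb @ B2 @ M @ C)) w \<ge> 2"
        using dM[of w] dNb[of w] w(2) by simp
      ultimately show ?thesis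
        using pinch_first[OF c, of ea w eb "deg i (edges_of (B1 @ Nb @ B2 @ M @ C))"]
          ids x cv w w0 that by auto
    qed
    have dN: "deg i (edges_of N) v = deg i (walk_edges ?p) v + (if v = w then 2 else 0)" for v
      using arg_cong[OF N(2), of "\<lambda>X. deg i X v"] ids ie cv by auto
    let ?cs = "A @ N @ B1 @ Nb @ B2 @ M @ C"
    have "staged (ear i r) i (\<lambda>_. 0) ?cs (\<lambda>_. 0)"
    proof -
      have "staged (ear i r) i (\<lambda>_. 0) A (deg i (edges_of (N @ B1 @ Nb @ B2 @ M @ C)))"
      proof (rule staged_cong[OF stA])
        fix a v assume "a \<in> set A" "v \<in> walk_verts a"
        then have "v \<noteq> w" using w(4)[of a] by auto
        then show "0 = 0 \<and> deg i (edges_of ((u, ?p) # B @ d # C)) v =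
            deg i (edges_of (N @ B1 @ Nb @ B2 @ M @ C)) v"
          using dM[of v] dNb[of v] dN[of v] by (simp add: B)
      qed
      moreover have "staged (ear i r) i (deg i (edges_of (A @ N))) B1
        (deg i (edges_of (Nb @ B2 @ M @ C)))"
      proof (rule staged_cong[OF stB1])
        fix a v assume "a \<in> set B1" "v \<in> walk_verts a"
        then have "v \<noteq> w" using w(4)[of a] by (auto simp: B)
        then show "deg i (edges_of (A @ [(u, ?p)])) v = deg i (edges_of (A @ N)) v \<and>
            deg i (edges_of (b # B2 @ d # C)) v = deg i (edges_of (Nb @ B2 @ M @ C)) v"
          using dM[of v] dNb[of v] dN[of v] by simp
      qed
      moreover have "staged (ear i r) i (deg i (edges_of (A @ N @ B1))) Nb
        (deg i (edges_of (B2 @ M @ C)))"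
        using dN by (intro staged_cong[OF Nb(1)]) simp
      moreover have "staged (ear i r) i (deg i (edges_of (A @ N @ B1 @ Nb))) B2
        (deg i (edges_of (M @ C)))"
      proof (rule staged_cong[OF stB2])
        fix a v assume "a \<in> set B2" "v \<in> walk_verts a"
        then have "v \<noteq> w" "v \<noteq> s" using w(4)[of a] B2[of a] by (auto simp: B)
        then show "deg i (edges_of (A @ (u, ?p) # B1 @ [b])) v = deg i (edges_of (A @ N @ B1 @ Nb)) v
          \<and> deg i (edges_of (d # C)) v = deg i (edges_of (M @ C)) v"
          using dM[of v] dNb[of v] dN[of v] by simp
      qed
      moreover have "staged (ear i r) i (deg i (edges_of (A @ N @ B1 @ Nb @ B2))) M
        (deg i (edges_of C))"
      \<comment> \<open>The earlier degrees at \<open>s\<close> and \<open>w\<close> have grown by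
        \<open>fa\<close>. Monotonicity suffices, since both vertices have earlier edges in any
        case.\<close>
      proof (rule staged_mono[OF M(1)])
        fix v
        show "deg i (edges_of (A @ (u, ?p) # B)) v + (if v = w then 2 else 0) \<le>
            deg i (edges_of (A @ N @ B1 @ Nb @ B2)) v"
          using dN[of v] dNb[of v] by (simp add: B)
        assume "deg i (edges_of (A @ (u, ?p) # B)) v + (if v = w then 2 else 0) = 0"
        then show "deg i (edges_of (A @ N @ B1 @ Nb @ B2)) v = 0"
          using dN[of v] dNb[of v] deg4 s by (cases "v = s") (auto simp: B)
      qed simp
      moreover have "staged (ear i r) i (deg i (edges_of (A @ N @ B1 @ Nb @ B2 @ M))) C (\<lambda>_. 0)"
      proof (rule staged_cong[OF stC])
        fix a v assume "a \<in> set C" "v \<in> walk_verts a"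
        then have "v \<noteq> w" using w(4)[of a] by (auto simp: B)
        then show "deg i (edges_of (A @ (u, ?p) # B @ [d])) v =
            deg i (edges_of (A @ N @ B1 @ Nb @ B2 @ M)) v \<and> (0::nat) = 0"
          using dM[of v] dNb[of v] dN[of v] by (simp add: B)
      qed
      ultimately show ?thesis using N(1) by (simp add: ac_simps)
    qed
    moreover have "edges_of ?cs + {#e, f#} = edges_of A + add_mset e (edges_of N) +
        edges_of B1 + edges_of Nb + edges_of B2 + add_mset f (edges_of M) + edges_of C"
      by simp
    ultimately show ?thesis
      unfolding N(2) M(2) Nb(2) by (intro exI[of _ ?cs]) (simp add: B)
  next
    case False
    then have s0: "deg i (edges_of B) s = 0" using deg_edges_of_notin[OF stB] by blast
    obtain N where N: "staged (ear i r) i (deg i (edges_of A)) N (deg i (edges_of (B @ M @ C)))"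
      "add_mset e (edges_of N) = walk_edges ?p + {#ea, eb, fa#}"
    proof -
      have "deg i (edges_of (B @ M @ C)) v = deg i (edges_of (B @ d # C)) v"
        if "v \<noteq> w" "v \<noteq> s" for v
        using dM[of v] that by simp
      moreover have "deg i (edges_of (B @ M @ C)) w \<ge> 1" using dM[of w] w(2) by simp
      moreover have "deg i (edges_of (B @ d # C)) s = 1" using s s0 by simp
      moreover have "deg i (edges_of A) s + deg i (walk_edges ?p) s + deg i (edges_of (B @ d # C)) s \<ge> 4"
        using deg4 by (simp add: ac_simps)
      ultimately show ?thesis
        using pinch_three[OF c x s(1) _ _ ids(1,2,4) w(1,2) cv(3) w0(1), of "deg i (edges_of (B @ M @ C))"]
          that by blast
    qed
    have dN: "deg i (edges_of N) v = deg i (walk_edges ?p) v + (if v = s then 1 else 0) +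
        (if v = w then 3 else 0)" for v
      using arg_cong[OF N(2), of "\<lambda>X. deg i X v"] ids ie cv by auto
    let ?cs = "A @ N @ B @ M @ C"
    have "staged (ear i r) i (\<lambda>_. 0) ?cs (\<lambda>_. 0)"
    proof -
      have "staged (ear i r) i (\<lambda>_. 0) A (deg i (edges_of (N @ B @ M @ C)))"
      proof (rule staged_cong[OF stA])
        fix a v assume "a \<in> set A" "v \<in> walk_verts a"
        then have "v \<noteq> w" using w(4)[of a] by auto
        then show "0 = 0 \<and> deg i (edges_of ((u, ?p) # B @ d # C)) v =
            deg i (edges_of (N @ B @ M @ C)) v"
          using dM[of v] dN[of v] by simp
      qed
      moreover have "staged (ear i r) i (deg i (edges_of (A @ N))) B (deg i (edges_of (M @ C)))"
      proof (rule staged_cong[OF stB])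
        fix a v assume "a \<in> set B" "v \<in> walk_verts a"
        then have "v \<noteq> w" "v \<noteq> s" using w(4)[of a] False by auto
        then show "deg i (edges_of (A @ [(u, ?p)])) v = deg i (edges_of (A @ N)) v \<and>
            deg i (edges_of (d # C)) v = deg i (edges_of (M @ C)) v"
          using dM[of v] dN[of v] by simp
      qed
      moreover have "staged (ear i r) i (deg i (edges_of (A @ N @ B))) M (deg i (edges_of C))"
      proof (rule staged_mono[OF M(1)])
        fix v
        show "deg i (edges_of (A @ (u, ?p) # B)) v + (if v = w then 2 else 0) \<le>
            deg i (edges_of (A @ N @ B)) v"
          using dN[of v] by simp
        assume "deg i (edges_of (A @ (u, ?p) # B)) v + (if v = w then 2 else 0) = 0"
        then show "deg i (edges_of (A @ N @ B)) v = 0"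
          using dN[of v] deg4 s by (cases "v = s") auto
      qed simp
      moreover have "staged (ear i r) i (deg i (edges_of (A @ N @ B @ M))) C (\<lambda>_. 0)"
      proof (rule staged_cong[OF stC])
        fix a v assume "a \<in> set C" "v \<in> walk_verts a"
        then have "v \<noteq> w" using w(4)[of a] by auto
        then show "deg i (edges_of (A @ (u, ?p) # B @ [d])) v =
            deg i (edges_of (A @ N @ B @ M)) v \<and> (0::nat) = 0"
          using dM[of v] dN[of v] by simp
      qed
      ultimately show ?thesis using N(1) by (simp add: ac_simps)
    qed
    moreover have "edges_of ?cs + {#e, f#} = edges_of A + add_mset e (edges_of N) +
        edges_of B + add_mset f (edges_of M) + edges_of C"
      by simp
    ultimately show ?thesis
      unfolding N(2) M(2) by (intro exI[of _ ?cs]) (simp add: add_mset_commute)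
  qed
qed

text \<open>The later ear is rebuilt first: for it only the two earlier edges at \<open>w\<close>
  matter, whereas the earlier ear has to know what follows it.\<close>

lemma pinch_apart:
  assumes st: "staged (ear i r) i (\<lambda>_. 0) (A @ c # B @ d # C) (\<lambda>_. 0)"
    and ef: "e \<in># walk_edges (snd c)" "f \<in># walk_edges (snd d)"
    and ids: "i e = Upair x y" "i f = Upair s t" "i ea = Upair x w" "i eb = Upair y w"
      "i fa = Upair s w" "i fb = Upair t w"
    and w: "w \<noteq> r" "\<And>a. a \<in> set (A @ c # B @ d # C) \<Longrightarrow> w \<notin> walk_verts a"
    and deg4: "\<And>v. v \<in> walk_verts d \<Longrightarrow> v \<noteq> r \<Longrightarrow> deg i (edges_of (A @ c # B @ d # C)) v \<ge> 4"
  shows "\<exists>cs'. staged (ear i r) i (\<lambda>_. 0) cs' (\<lambda>_. 0) \<and> edges_of cs' + {#e, f#} =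
    edges_of (A @ c # B @ d # C) + {#ea, eb, fa, fb#}"
proof -
  have c0: "ear i r (deg i (edges_of A)) (\<lambda>v. deg i (edges_of (B @ d # C)) v) c"
    and stA: "staged (ear i r) i (\<lambda>_. 0) A (deg i (edges_of (c # B @ d # C)))"
    and stB: "staged (ear i r) i (deg i (edges_of (A @ [c]))) B (deg i (edges_of (d # C)))"
    and stC: "staged (ear i r) i (deg i (edges_of (A @ c # B @ [d]))) C (\<lambda>_. 0)"
    and d0: "ear i r (deg i (edges_of (A @ c # B))) (deg i (edges_of C)) d"
    using st by (simp_all add: ac_simps)
  obtain u p y' q ea' eb' where c: "c = (u, p @ (e, y') # q)" and ie: "i e = Upair (target u p) y'"
    and ids1: "i ea' = Upair (target u p) w" "i eb' = Upair y' w"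
      "target u p = x \<and> y' = y \<and> ea' = ea \<and> eb' = eb \<or>
       target u p = y \<and> y' = x \<and> ea' = eb \<and> eb' = ea"
    by (rule ear_edge_split[OF c0 ef(1) ids(1,3,4)])
  obtain u2 p2 t' q2 fa' fb' where d: "d = (u2, p2 @ (f, t') # q2)"
    and "if": "i f = Upair (target u2 p2) t'"
    and ids2: "i fa' = Upair (target u2 p2) w" "i fb' = Upair t' w"
      "target u2 p2 = s \<and> t' = t \<and> fa' = fa \<and> fb' = fb \<or>
       target u2 p2 = t \<and> t' = s \<and> fa' = fb \<and> fb' = fa"
    by (rule ear_edge_split[OF d0 ef(2) ids(2,5,6)])
  let ?s = "target u2 p2"
  have goal: "{#ea, eb#} = {#ea', eb'#}" "{#fa, fb#} = {#fa', fb'#}"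
    using ids1(3) ids2(3) by (auto simp: add_mset_commute)
  have edges_goal: "E + {#ea, eb, fa, fb#} = E + {#ea', eb', fa', fb'#}" for E
  proof -
    have "E + {#ea, eb, fa, fb#} = E + {#ea, eb#} + {#fa, fb#}" by simp
    also have "\<dots> = E + {#ea', eb'#} + {#fa', fb'#}" unfolding goal ..
    finally show ?thesis by simp
  qed
  have w0: "deg i (edges_of A) w = 0" "deg i (edges_of B) w = 0"
    "deg i (walk_edges (snd c)) w = 0" "deg i (walk_edges (snd d)) w = 0"
    using deg_edges_of_notin[OF st] deg_edges_of_notin[OF stA] deg_edges_of_notin[OF stB] w(2)
    by auto
  have cv: "w \<notin> walk_verts c" "w \<notin> walk_verts d" using w(2) by auto
  have wv: "w \<noteq> target u p" "w \<noteq> y'" "w \<noteq> ?s" "w \<noteq> t'"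
    using cv target_split_in_verts[of u p "(e, y') # q"] target_split_in_verts[of u2 p2 "(f, t') # q2"]
    by (auto simp: c d walk_verts_Pair)
  \<comment> \<open>The \<open>2\<close> stands for the half edges \<open>ea\<close> and
    \<open>eb\<close>.\<close>
  let ?h = "\<lambda>v. deg i (edges_of (A @ c # B)) v + (if v = w then 2 else 0)"
  consider
    (inplace) M where "staged (ear i r) i ?h M (deg i (edges_of C))"
      "add_mset f (edges_of M) = walk_edges (snd d) + {#fa', fb'#}"
  | (first) M where "?s \<noteq> r" "deg i (edges_of C) ?s = 0" "deg i (walk_edges (snd d)) ?s = 1"
      "staged (ear i r) i ?h M (deg i (edges_of C))"
      "add_mset f (edges_of M) = walk_edges (snd d) + {#fb'#}"
  | (second) M where "t' \<noteq> r" "deg i (edges_of C) t' = 0" "deg i (walk_edges (snd d)) t' = 1"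
      "staged (ear i r) i ?h M (deg i (edges_of C))"
      "add_mset f (edges_of M) = walk_edges (snd d) + {#fa'#}"
    using pinch_last[OF d0[unfolded d] refl ids2(1,2) w(1) cv(2)[unfolded d],
        of ?h] w0 unfolding d by auto
  then show ?thesis
  proof cases
    case inplace
    have dM: "deg i (edges_of M) v = deg i (walk_edges (snd d)) v + (if v = w then 2 else 0)" for v
      using arg_cong[OF inplace(2), of "\<lambda>X. deg i X v"] ids2 "if" wv by auto
    have "\<exists>N. staged (ear i r) i (deg i (edges_of A)) N (deg i (edges_of (B @ M @ C))) \<and>
        add_mset e (edges_of N) = walk_edges (p @ (e, y') # q) + {#ea', eb'#}"
      by (rule pinch_first[OF c0[unfolded c] ids1(1,2) w(1) cv(1)[unfolded c] w0(1)])
        (use dM in auto)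
    then obtain N where N: "staged (ear i r) i (deg i (edges_of A)) N (deg i (edges_of (B @ M @ C)))"
        "add_mset e (edges_of N) = walk_edges (snd c) + {#ea', eb'#}"
      unfolding c by auto
    have dN: "deg i (edges_of N) v = deg i (walk_edges (snd c)) v + (if v = w then 2 else 0)" for v
      using arg_cong[OF N(2), of "\<lambda>X. deg i X v"] ids1 ie wv by auto
    let ?cs = "A @ N @ B @ M @ C"
    have "staged (ear i r) i (\<lambda>_. 0) ?cs (\<lambda>_. 0)"
    proof -
      have "staged (ear i r) i (\<lambda>_. 0) A (deg i (edges_of (N @ B @ M @ C)))"
      proof (rule staged_cong[OF stA])
        fix a v assume "a \<in> set A" "v \<in> walk_verts a"
        then have "v \<noteq> w" using w(2)[of a] by auto
        then show "0 = 0 \<and> deg i (edges_of (c # B @ d # C)) v = deg i (edges_of (N @ B @ M @ C)) v"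
          using dM[of v] dN[of v] by simp
      qed
      moreover have "staged (ear i r) i (deg i (edges_of (A @ N))) B (deg i (edges_of (M @ C)))"
      proof (rule staged_cong[OF stB])
        fix a v assume "a \<in> set B" "v \<in> walk_verts a"
        then have "v \<noteq> w" using w(2)[of a] by auto
        then show "deg i (edges_of (A @ [c])) v = deg i (edges_of (A @ N)) v \<and>
            deg i (edges_of (d # C)) v = deg i (edges_of (M @ C)) v"
          using dM[of v] dN[of v] by simp
      qed
      moreover have "staged (ear i r) i (deg i (edges_of (A @ N @ B))) M (deg i (edges_of C))"
        using dN by (intro staged_cong[OF inplace(1)]) simp
      moreover have "staged (ear i r) i (deg i (edges_of (A @ N @ B @ M))) C (\<lambda>_. 0)"
      proof (rule staged_cong[OF stC])
        fix a v assume "a \<in> set C" "v \<in> walk_verts a"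
        then have "v \<noteq> w" using w(2)[of a] by auto
        then show "deg i (edges_of (A @ c # B @ [d])) v =
            deg i (edges_of (A @ N @ B @ M)) v \<and> (0::nat) = 0"
          using dM[of v] dN[of v] by simp
      qed
      ultimately show ?thesis using N(1) by (simp add: ac_simps)
    qed
    moreover have "edges_of ?cs + {#e, f#} = edges_of A + add_mset e (edges_of N) +
        edges_of B + add_mset f (edges_of M) + edges_of C"
      by simp
    ultimately show ?thesis
      unfolding N(2) inplace(2) edges_goal by (intro exI[of _ ?cs]) simp
  next
    case first
    have "?s \<in> walk_verts d" unfolding d by (rule target_split_in_verts)
    then show ?thesis
      using pinch_apart_last[OF st[unfolded c] refl ids1(1,2) "if" ids2(1,2) w(1) wv(3,4)
          w(2)[unfolded c] first(1-3) deg4[unfolded c] first(4)[unfolded c] first(5)] first(1)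
      unfolding c edges_goal by blast
  next
    case second
    have "t' \<in> walk_verts d" unfolding d by (simp add: walk_verts_Pair)
    moreover have "i f = Upair t' ?s" using "if" by (simp add: Upair_inject)
    moreover have "E + {#ea', eb', fa', fb'#} = E + {#ea', eb', fb', fa'#}" for E
      by (simp add: add_mset_commute)
    ultimately show ?thesis
      using pinch_apart_last[OF st[unfolded c] refl ids1(1,2) _ ids2(2,1) w(1) wv(4,3)
          w(2)[unfolded c] second(1-3) deg4[unfolded c] second(4)[unfolded c] second(5)] second(1)
      unfolding c edges_goal by metis
  qed
qed

lemma pinch_same:
  assumes st: "staged (ear i r) i (\<lambda>_. 0) (A @ c # B) (\<lambda>_. 0)"
    and ef: "e \<in># walk_edges (snd c)" "f \<in># walk_edges (snd c)" "e \<noteq> f"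
    and ids: "i e = Upair x y" "i f = Upair s t" "i ea = Upair x w" "i eb = Upair y w"
      "i fa = Upair s w" "i fb = Upair t w"
    and w: "w \<noteq> r" "\<And>a. a \<in> set (A @ c # B) \<Longrightarrow> w \<notin> walk_verts a"
  shows "\<exists>cs'. staged (ear i r) i (\<lambda>_. 0) cs' (\<lambda>_. 0) \<and> edges_of cs' + {#e, f#} =
    edges_of (A @ c # B) + {#ea, eb, fa, fb#}"
proof -
  have c0: "ear i r (deg i (edges_of A)) (\<lambda>v. deg i (edges_of B) v) c"
    and stA: "staged (ear i r) i (\<lambda>_. 0) A (deg i (edges_of (c # B)))"
    and stB: "staged (ear i r) i (deg i (edges_of (A @ [c]))) B (\<lambda>_. 0)"
    using st by (simp_all add: ac_simps)
  have w0: "deg i (edges_of A) w = 0" "deg i (walk_edges (snd c)) w = 0"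
    using deg_edges_of_notin[OF st] deg_edges_of_notin[OF stA] w(2) by auto
  have cv: "w \<notin> walk_verts c" using w(2) by auto
  obtain u p0 where c: "c = (u, p0)" by (cases c)
  have walk: "walk i u p0" using earD(2) c0 unfolding c by metis
  \<comment> \<open>Proved for arbitrary names, so that the roles of \<open>e\<close> and
    \<open>f\<close> can be exchanged when \<open>f\<close> comes first on the ear.\<close>
  have main: "\<exists>N. staged (ear i r) i (deg i (edges_of A)) N (deg i (edges_of B)) \<and>
      edges_of N + {#e, f#} = walk_edges (snd c) + {#ea, eb, fa, fb#}"
    if p0: "p0 = p @ (e, y') # p' @ (f, t') # p''"
      and ids: "i e = Upair x y" "i f = Upair s t" "i ea = Upair x w" "i eb = Upair y w"
        "i fa = Upair s w" "i fb = Upair t w"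
    for p y' p' t' p'' e f x y s t ea eb fa fb
  proof -
    let ?x = "target u p" and ?s = "target y' p'"
    obtain ea' eb' where e': "i ea' = Upair ?x w" "i eb' = Upair y' w" "{#ea, eb#} = {#ea', eb'#}"
    proof -
      have "?x = x \<and> y' = y \<or> ?x = y \<and> y' = x"
        using walk ids(1) p0 by (auto simp: Upair_inject)
      then show ?thesis using ids that[of ea eb] that[of eb ea] by (auto simp: add_mset_commute)
    qed
    obtain fa' fb' where f': "i fa' = Upair ?s w" "i fb' = Upair t' w" "{#fa, fb#} = {#fa', fb'#}"
    proof -
      have "?s = s \<and> t' = t \<or> ?s = t \<and> t' = s"
        using walk ids(2) p0 by (auto simp: Upair_inject)
      then show ?thesis using ids that[of fa fb] that[of fb fa] by (auto simp: add_mset_commute)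
    qed
    have goal: "E + {#ea, eb, fa, fb#} = E + {#ea', eb', fa', fb'#}" for E
    proof -
      have "E + {#ea, eb, fa, fb#} = E + {#ea, eb#} + {#fa, fb#}" by simp
      also have "\<dots> = E + {#ea', eb'#} + {#fa', fb'#}" unfolding e'(3) f'(3) ..
      finally show ?thesis by simp
    qed
    from c0 show ?thesis
      unfolding c p0 goal snd_conv
    proof (cases rule: ear_cases)
      case rising
      then show "\<exists>N. staged (ear i r) i (deg i (edges_of A)) N (deg i (edges_of B)) \<and> edges_of N + {#e, f#} =
        walk_edges (p @ (e, y') # p' @ (f, t') # p'') + {#ea', eb', fa', fb'#}"
        using c0 cv w(1) w0(1) e' f' unfolding c p0 by (intro pinch_same_up) auto
    next
      case falling
      then show "\<exists>N. staged (ear i r) i (deg i (edges_of A)) N (deg i (edges_of B)) \<and> edges_of N + {#e, f#} =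
        walk_edges (p @ (e, y') # p' @ (f, t') # p'') + {#ea', eb', fa', fb'#}"
        using c0 cv w(1) w0(1) e' f' unfolding c p0 by (intro pinch_same_down) auto
    qed (auto simp: bridging_def)
  qed
  have "\<exists>N. staged (ear i r) i (deg i (edges_of A)) N (deg i (edges_of B)) \<and>
      edges_of N + {#e, f#} = walk_edges (snd c) + {#ea, eb, fa, fb#}"
  proof -
    obtain y' t' where "(e, y') \<in> set p0" "(f, t') \<in> set p0"
      using ef(1,2) by (auto simp: walk_edges_def c)
    from split_list[OF \<open>(e, y') \<in> set p0\<close>] obtain p q where pq: "p0 = p @ (e, y') # q" by blast
    with \<open>(f, t') \<in> set p0\<close> ef(3) have "(f, t') \<in> set p \<or> (f, t') \<in> set q" by auto
    then show ?thesis
    proof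
      assume "(f, t') \<in> set q"
      then obtain p' p'' where "q = p' @ (f, t') # p''" by (meson split_list)
      then have "p0 = p @ (e, y') # p' @ (f, t') # p''" using pq by simp
      from main[OF this ids] show ?thesis .
    next
      assume "(f, t') \<in> set p"
      then obtain p' p'' where p: "p = p' @ (f, t') # p''" by (meson split_list)
      then have "p0 = p' @ (f, t') # p'' @ (e, y') # q" using pq by simp
      from main[OF this ids(2,1,5,6,3,4)] show ?thesis by (simp add: add_mset_commute)
    qed
  qed
  then obtain N where N: "staged (ear i r) i (deg i (edges_of A)) N (deg i (edges_of B))"
      "edges_of N + {#e, f#} = walk_edges (snd c) + {#ea, eb, fa, fb#}"
    by blast
  have ev: "v \<noteq> w \<Longrightarrow> deg i (edges_of N) v = deg i (walk_edges (snd c)) v" for v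
    using arg_cong[OF N(2), of "\<lambda>X. deg i X v"] ids by simp
  let ?cs = "A @ N @ B"
  have "staged (ear i r) i (\<lambda>_. 0) ?cs (\<lambda>_. 0)"
  proof -
    have "staged (ear i r) i (\<lambda>_. 0) A (deg i (edges_of (N @ B)))"
    proof (rule staged_cong[OF stA])
      fix a v assume "a \<in> set A" "v \<in> walk_verts a"
      then have "v \<noteq> w" using w(2)[of a] by auto
      then show "0 = 0 \<and> deg i (edges_of (c # B)) v = deg i (edges_of (N @ B)) v"
        using ev[of v] by simp
    qed
    moreover have "staged (ear i r) i (deg i (edges_of (A @ N))) B (\<lambda>_. 0)"
    proof (rule staged_cong[OF stB])
      fix a v assume "a \<in> set B" "v \<in> walk_verts a"
      then have "v \<noteq> w" using w(2)[of a] by auto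
      then show "deg i (edges_of (A @ [c])) v = deg i (edges_of (A @ N)) v \<and> (0::nat) = 0"
        using ev[of v] by simp
    qed
    ultimately show ?thesis using N(1) by (simp add: ac_simps)
  qed
  moreover have "edges_of ?cs + {#e, f#} = edges_of A + (edges_of N + {#e, f#}) + edges_of B"
    by simp
  ultimately show ?thesis unfolding N(2) by (intro exI[of _ ?cs]) simp
qed

lemma pinch:
  assumes st: "staged (ear i r) i (\<lambda>_. 0) cs (\<lambda>_. 0)"
    and ef: "e \<in># edges_of cs" "f \<in># edges_of cs" "e \<noteq> f"
    and ids: "i e = Upair x y" "i f = Upair s t" "i ea = Upair x w" "i eb = Upair y w"
      "i fa = Upair s w" "i fb = Upair t w"
    and w: "w \<noteq> r" "\<And>a. a \<in> set cs \<Longrightarrow> w \<notin> walk_verts a"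
    and deg4: "\<And>a v. a \<in> set cs \<Longrightarrow> v \<in> walk_verts a \<Longrightarrow> v \<noteq> r \<Longrightarrow> deg i (edges_of cs) v \<ge> 4"
  shows "\<exists>cs'. staged (ear i r) i (\<lambda>_. 0) cs' (\<lambda>_. 0) \<and>
    edges_of cs' + {#e, f#} = edges_of cs + {#ea, eb, fa, fb#}"
proof -
  have ex: "\<exists>c \<in> set cs. g \<in># walk_edges (snd c)" if "g \<in># edges_of cs" for g
    using that by (induction cs) auto
  obtain c where c: "c \<in> set cs" "e \<in># walk_edges (snd c)" using ex ef(1) by blast
  obtain d where d: "d \<in> set cs" "f \<in># walk_edges (snd d)" using ex ef(2) by blast
  obtain A B where cs: "cs = A @ c # B" using c(1) by (meson split_list)
  have comm: "{#f, e#} = {#e, f#}" "E + {#fa, fb, ea, eb#} = E + {#ea, eb, fa, fb#}" for E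
    by (simp_all add: add_mset_commute)
  consider "d = c" | "d \<in> set B" | "d \<in> set A" using d(1) cs by auto
  then show ?thesis
  proof cases
    case 1
    then show ?thesis
      using pinch_same[of i r A c B e f x y s t ea w eb fa fb] st c d ef ids w unfolding cs by blast
  next
    case 2
    then obtain B1 B2 where B: "B = B1 @ d # B2" by (meson split_list)
    show ?thesis
      unfolding cs B
      by (rule pinch_apart[OF st[unfolded cs B] c(2) d(2) ids w(1) w(2)[unfolded cs B]
            deg4[unfolded cs B]]) auto
  next
    case 3
    then obtain A1 A2 where A: "A = A1 @ d # A2" by (meson split_list)
    have cs': "cs = A1 @ d # A2 @ c # B" using cs A by simp
    have "\<exists>cs'. staged (ear i r) i (\<lambda>_. 0) cs' (\<lambda>_. 0) \<and> edges_of cs' + {#f, e#} =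
      edges_of cs + {#fa, fb, ea, eb#}"
      unfolding cs'
      by (rule pinch_apart[OF st[unfolded cs'] d(2) c(2) ids(2,1,5,6,3,4) w(1) w(2)[unfolded cs']
            deg4[unfolded cs']]) auto
    then show ?thesis unfolding comm .
  qed
qed

section \<open>Reinserting a deleted edge\<close>

lemma late_gap:
  assumes st: "staged (ear i r) i (\<lambda>_. 0) cs (\<lambda>_. 0)"
    and deg4: "y \<noteq> r \<Longrightarrow> deg i (edges_of cs) y \<ge> 4"
  shows "\<exists>n. late r (deg i (edges_of (take n cs))) y \<and> late r (deg i (edges_of (drop n cs))) y"
proof (cases "y = r")
  case False
  let ?P = "\<lambda>n. late r (deg i (edges_of (take n cs))) y"
  \<comment> \<open>At the first moment when \<open>y\<close> is late, it has just entered with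
    exactly two edges, so at least two of its four or more edges are still to come.\<close>
  have "?P (length cs)" using deg4 False by (simp add: late_def)
  then have least: "?P (LEAST n. ?P n)" by (rule LeastI)
  obtain m where m: "(LEAST n. ?P n) = Suc m"
    using least False by (cases "LEAST n. ?P n") (auto simp: late_def)
  have nm: "\<not> ?P m" by (rule not_less_Least) (simp add: m)
  have ml: "m < length cs"
    using nm least m by (cases "m < length cs") auto
  define A B c where "A = take m cs" and "B = drop (Suc m) cs" and "c = cs ! m"
  have cs: "cs = A @ c # B" unfolding A_def B_def c_def using ml by (rule id_take_nth_drop)
  have tk: "take (Suc m) cs = A @ [c]" unfolding A_def c_def using ml by (rule take_Suc_conv_app_nth)
  obtain u p where c: "c = (u, p)" by (cases c)
  have e: "ear i r (deg i (edges_of A)) (deg i (edges_of B)) (u, p)"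
    using st by (simp add: cs c)
  have nA: "\<not> late r (deg i (edges_of A)) y" using nm by (simp add: A_def)
  have "y \<in> walk_verts (u, p)"
  proof (rule ccontr)
    assume "y \<notin> walk_verts (u, p)"
    then have "deg i (walk_edges p) y = 0" by (rule deg_walk_notin[OF earD(2)[OF e]])
    then show False using least nA unfolding m tk by (simp add: late_def c)
  qed
  from ear_not_late(3,4)[OF e this nA] have "deg i (edges_of B) y \<ge> 2"
    using deg4 False by (simp add: cs c)
  then show ?thesis using least unfolding m B_def by (auto simp: late_def)
qed (auto simp: late_def)

text \<open>Of the two moments that \<open>late_gap\<close> gives for \<open>x\<close> and
  \<open>y\<close>, the later one works: both ends are late by then, and the end to which it belongs
  still has two later edges.\<close>

lemma insert_edge:
  assumes st: "staged (ear i r) i (\<lambda>_. 0) cs (\<lambda>_. 0)"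
    and deg4: "\<And>v. v \<in> {x, y} \<Longrightarrow> v \<noteq> r \<Longrightarrow> deg i (edges_of cs) v \<ge> 4"
    and g: "i g = Upair x y"
  shows "\<exists>cs'. staged (ear i r) i (\<lambda>_. 0) cs' (\<lambda>_. 0) \<and> edges_of cs' = add_mset g (edges_of cs)"
proof -
  obtain m where m: "late r (deg i (edges_of (take m cs))) x" "late r (deg i (edges_of (drop m cs))) x"
    using late_gap[OF st, of x] deg4 by blast
  obtain n where n: "late r (deg i (edges_of (take n cs))) y" "late r (deg i (edges_of (drop n cs))) y"
    using late_gap[OF st, of y] deg4 by blast
  have mono: "late r (deg i (edges_of (take j cs))) v"
    if "late r (deg i (edges_of (take k cs))) v" "k \<le> j" for j k v
  proof -
    have "take j cs = take k cs @ drop k (take j cs)" using that(2)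
      by (metis append_take_drop_id min.absorb1 take_take)
    from arg_cong[OF this, of edges_of] show ?thesis
      by (intro late_mono[OF that(1)]) simp
  qed
  obtain j where j: "late r (deg i (edges_of (take j cs))) x" "late r (deg i (edges_of (take j cs))) y"
    "late r (deg i (edges_of (drop j cs))) x \<or> late r (deg i (edges_of (drop j cs))) y"
    using m n mono[of m x n] mono[of n y m] by (metis nle_le)
  define A B where "A = take j cs" and "B = drop j cs"
  have cs: "cs = A @ B" by (simp add: A_def B_def)
  let ?c = "(x, [(g, y)])"
  have "ear i r (deg i (edges_of A)) (deg i (edges_of B)) ?c"
    using j g by (auto simp: ear.simps bridging_def A_def B_def)
  moreover have "staged (ear i r) i (\<lambda>_. 0) A (deg i (edges_of (?c # B)))"
    using st by (auto simp: cs elim!: staged_mono)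
  moreover have "staged (ear i r) i (deg i (edges_of (A @ [?c]))) B (\<lambda>_. 0)"
  proof (rule staged_mono)
    show "staged (ear i r) i (deg i (edges_of A)) B (\<lambda>_. 0)" using st by (simp add: cs)
    fix v assume v: "v \<noteq> r" "deg i (edges_of A) v = 0"
    then have "v \<noteq> x" "v \<noteq> y" using j(1,2) unfolding A_def late_def by auto
    then show "deg i (edges_of (A @ [?c])) v = 0" using v(2) g by simp
  qed simp_all
  ultimately have "staged (ear i r) i (\<lambda>_. 0) (A @ ?c # B) (\<lambda>_. 0)" by (simp add: ac_simps)
  then show ?thesis by (intro exI[of _ "A @ ?c # B"]) (simp add: cs)
qed

subsection \<open>Cuts and splitting off\<close>

text \<open>A loop crosses no set, so loops do not count in cuts.\<close>

definition crosses :: "'v uprod \<Rightarrow> 'v set \<Rightarrow> bool" where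
  "crosses a X \<longleftrightarrow> set_uprod a \<inter> X \<noteq> {} \<and> \<not> set_uprod a \<subseteq> X"

lemma crosses_Upair [simp]: "crosses (Upair a b) X \<longleftrightarrow> (a \<in> X) \<noteq> (b \<in> X)"
  by (auto simp: crosses_def)

text \<open>A sum of indicators instead of a cardinality: inequalities between cuts reduce to a
  check for a single edge.\<close>

definition cut_size :: "('e \<Rightarrow> 'v uprod) \<Rightarrow> 'e set \<Rightarrow> 'v set \<Rightarrow> nat" where
  "cut_size i E X = (\<Sum>e\<in>E. of_bool (crosses (i e) X))"

lemma uprod_cases: obtains a b where "u = Upair a b"
  by (cases u) auto

lemma cut_size_Compl:
  assumes "\<And>e. e \<in> E \<Longrightarrow> set_uprod (i e) \<subseteq> V"
  shows "cut_size i E (V - X) = cut_size i E X"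
  unfolding cut_size_def
proof (rule sum.cong)
  fix e assume "e \<in> E"
  with assms[of e] show "(of_bool (crosses (i e) (V - X)) :: nat) = of_bool (crosses (i e) X)"
    by (cases "i e") auto
qed simp

lemma cut_size_submodular:
  "cut_size i E (X \<inter> Y) + cut_size i E (X \<union> Y) \<le> cut_size i E X + cut_size i E Y"
proof -
  have "of_bool (crosses a (X \<inter> Y)) + of_bool (crosses a (X \<union> Y)) \<le>
      of_bool (crosses a X) + (of_bool (crosses a Y) :: nat)" for a
    by (cases a) auto
  then show ?thesis unfolding cut_size_def sum.distrib[symmetric] by (intro sum_mono)
qed

text \<open>Holds edge by edge: whatever the position of its two ends relative to the three sets, an
  edge counts on the left at most as often as on the right.\<close>

lemma cut_size_three:
  "cut_size i E (X \<inter> Y \<inter> Z) + cut_size i E (X - Y - Z) + cut_size i E (Y - X - Z) +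
     cut_size i E (Z - X - Y) \<le> cut_size i E X + cut_size i E Y + cut_size i E Z"
proof -
  have "of_bool (crosses a (X \<inter> Y \<inter> Z)) + of_bool (crosses a (X - Y - Z)) +
      of_bool (crosses a (Y - X - Z)) + of_bool (crosses a (Z - X - Y)) \<le>
      of_bool (crosses a X) + of_bool (crosses a Y) + (of_bool (crosses a Z) :: nat)" for a
  proof -
    obtain x y where "a = Upair x y" by (rule uprod_cases)
    then show ?thesis
      by (cases "x \<in> X"; cases "x \<in> Y"; cases "x \<in> Z"; cases "y \<in> X"; cases "y \<in> Y"; cases "y \<in> Z")
        simp_all
  qed
  then show ?thesis unfolding cut_size_def sum.distrib[symmetric] by (intro sum_mono)
qed

lemma deg_mset_set: "deg i (mset_set E) v = (\<Sum>e\<in>E. inc (i e) v)"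
  by (simp add: deg_def sum_unfold_sum_mset)

lemma cut_size_le_deg: "cut_size i E {v} \<le> deg i (mset_set E) v"
proof -
  have "of_bool (crosses a {v}) \<le> inc a v" for a
    by (cases a) auto
  then show ?thesis unfolding cut_size_def deg_mset_set by (intro sum_mono)
qed

text \<open>Mader: if every edge lies in a tight cut, an inclusion-minimal tight set avoiding \<open>r\<close>
  is a single vertex, since a tight set splitting it could be uncrossed with it.\<close>

lemma tight_vertex:
  assumes fin: "finite V" and r: "r \<in> V" and E: "\<And>e. e \<in> E \<Longrightarrow> set_uprod (i e) \<subseteq> V" "E \<noteq> {}"
    and cut: "\<And>X. X \<subset> V \<Longrightarrow> X \<noteq> {} \<Longrightarrow> cut_size i E X \<ge> 4"
    and tight: "\<And>e. e \<in> E \<Longrightarrow> \<exists>X. X \<subset> V \<and> crosses (i e) X \<and> cut_size i E X = 4"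
  shows "\<exists>w \<in> V. w \<noteq> r \<and> cut_size i E {w} = 4"
proof -
  let ?T = "\<lambda>X. X \<subseteq> V - {r} \<and> X \<noteq> {} \<and> cut_size i E X = 4"
  \<comment> \<open>Passing to the complement if necessary, tight sets can be taken to avoid
    \<open>r\<close>, so that the union of two of them is still proper in \<open>V\<close>.\<close>
  have T: "\<exists>X. ?T X \<and> crosses (i e) X" if e: "e \<in> E" for e
  proof -
    obtain X where X: "X \<subset> V" "crosses (i e) X" "cut_size i E X = 4" using tight[OF e] by blast
    show ?thesis
    proof (cases "r \<in> X")
      case False
      then show ?thesis using X by (intro exI[of _ X]) (auto simp: crosses_def)
    next
      case True
      have "crosses (i e) (V - X)" using X(2) E(1)[OF e] by (cases "i e") auto
      then show ?thesis using True X cut_size_Compl[of E i V X] E(1)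
        by (intro exI[of _ "V - X"]) auto
    qed
  qed
  then obtain X0 where "?T X0" using E(2) by blast
  from ex_has_least_nat[of ?T, OF this, of card]
  obtain X where least: "?T X \<and> (\<forall>Y. ?T Y \<longrightarrow> card X \<le> card Y)"
    by (rule exE)
  then have X: "?T X" by (rule conjunct1)
  have min: "card X \<le> card Y" if "?T Y" for Y using conjunct2[OF least] that by blast
  obtain a where a: "a \<in> X" using X by blast
  have "X = {a}"
  proof (rule ccontr)
    assume ne: "X \<noteq> {a}"
    show False
    proof (cases "\<exists>e \<in> E. set_uprod (i e) \<subseteq> X")
      case False
      \<comment> \<open>With no edge inside \<open>X\<close>, its cut is divided between
        \<open>{a}\<close> and \<open>X - {a}\<close>, each of cut size at least four.\<close>
      have "of_bool (crosses (i e) {a}) + of_bool (crosses (i e) (X - {a})) \<le>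
          (of_bool (crosses (i e) X) :: nat)" if "e \<in> E" for e
      proof -
        obtain p q where pq: "i e = Upair p q" by (rule uprod_cases)
        then have "p \<notin> X \<or> q \<notin> X" using False that by auto
        then show ?thesis using a pq
          by (cases "p = a"; cases "q = a"; cases "p \<in> X"; cases "q \<in> X") simp_all
      qed
      then have "cut_size i E {a} + cut_size i E (X - {a}) \<le> cut_size i E X"
        unfolding cut_size_def sum.distrib[symmetric] by (intro sum_mono)
      moreover have "cut_size i E {a} \<ge> 4" using X a r by (intro cut) auto
      moreover have "cut_size i E (X - {a}) \<ge> 4" using X a ne r by (intro cut) auto
      ultimately show False using X by simp
    next
      case True
      then obtain e where e: "e \<in> E" "set_uprod (i e) \<subseteq> X" by blast
      obtain Y where Y: "?T Y" "crosses (i e) Y" using T[OF e(1)] by blast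
      have ne: "X \<inter> Y \<noteq> {}" "X \<inter> Y \<subset> X" using Y(2) e(2) by (cases "i e"; auto)+
      \<comment> \<open>Submodularity leaves at most 4 + 4 for the two, so
        \<open>X \<inter> Y\<close> is a smaller tight set.\<close>
      have "cut_size i E (X \<inter> Y) \<ge> 4" "cut_size i E (X \<union> Y) \<ge> 4"
        using X Y ne r by (auto intro!: cut)
      then have "cut_size i E (X \<inter> Y) = 4"
        using cut_size_submodular[of i E X Y] X Y(1) by linarith
      then have "card X \<le> card (X \<inter> Y)" using X ne(1) by (intro min) auto
      moreover have "finite X" using X fin by (meson finite_Diff finite_subset)
      ultimately show False using psubset_card_mono[OF _ ne(2)] by simp
    qed
  qed
  then show ?thesis using X by auto
qed

text \<open>Lovasz splitting at a vertex with the four neighbours \<open>a, b, c, d\<close>: if all three pairings failed,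
  three sets violating them would contradict the inequality for three sets.\<close>

lemma splitting:
  fixes i :: "'e \<Rightarrow> 'v uprod" and E :: "'e set"
  defines "\<delta> \<equiv> cut_size i E"
  assumes E: "\<And>e. e \<in> E \<Longrightarrow> set_uprod (i e) \<subseteq> V" and V: "a \<in> V" "b \<in> V" "c \<in> V" "d \<in> V"
    and inside: "\<And>X. X \<subseteq> V \<Longrightarrow> X \<noteq> {} \<Longrightarrow>
      4 \<le> \<delta> X + of_bool (a \<in> X) + of_bool (b \<in> X) + of_bool (c \<in> X) + of_bool (d \<in> X)"
  defines "good \<equiv> \<lambda>a b c d. \<forall>X. X \<subset> V \<longrightarrow> X \<noteq> {} \<longrightarrow>
      4 \<le> \<delta> X + of_bool ((a \<in> X) \<noteq> (b \<in> X)) + of_bool ((c \<in> X) \<noteq> (d \<in> X))"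
  shows "good a b c d \<or> good a c b d \<or> good a d b c"
proof -
  have compl: "\<delta> (V - X) = \<delta> X" for X
    unfolding \<delta>_def by (rule cut_size_Compl[OF E])
  \<comment> \<open>If \<open>n\<close> of the four neighbours lie in \<open>X\<close>, then
    \<open>inside\<close> for \<open>X\<close> and for its complement bounds the cut size from below
    by \<open>4 - n\<close> and by \<open>n\<close>. A pair separated by \<open>X\<close> is then
    incompatible with the violation; so one pair lies inside, the other outside.\<close>
  have bad: "\<exists>X \<subseteq> V. \<delta> X \<le> 3 \<and> a \<in> X \<and> b' \<in> X \<and> c' \<notin> X \<and> d' \<notin> X"
    if fails: "\<not> good a b' c' d'" and V': "b' \<in> V" "c' \<in> V" "d' \<in> V"
      and perm: "\<And>X. of_bool (b \<in> X) + of_bool (c \<in> X) + of_bool (d \<in> X) =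
        of_bool (b' \<in> X) + of_bool (c' \<in> X) + (of_bool (d' \<in> X) :: nat)" for b' c' d'
  proof -
    obtain X where X: "X \<subset> V" "X \<noteq> {}"
      "\<delta> X + of_bool ((a \<in> X) \<noteq> (b' \<in> X)) + of_bool ((c' \<in> X) \<noteq> (d' \<in> X)) < 4"
    proof -
      have "\<exists>X. X \<subset> V \<and> X \<noteq> {} \<and>
          \<not> 4 \<le> \<delta> X + of_bool ((a \<in> X) \<noteq> (b' \<in> X)) + of_bool ((c' \<in> X) \<noteq> (d' \<in> X))"
        using fails by (simp only: good_def not_all not_imp)
      then show ?thesis using that by (auto simp only: not_le)
    qed
    have 1: "4 \<le> \<delta> X + of_bool (a \<in> X) + of_bool (b' \<in> X) + of_bool (c' \<in> X) + of_bool (d' \<in> X)"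
      using inside[OF psubset_imp_subset[OF X(1)] X(2)] perm[of X] by linarith
    have 2: "4 \<le> \<delta> X + of_bool (a \<notin> X) + of_bool (b' \<notin> X) + of_bool (c' \<notin> X) + of_bool (d' \<notin> X)"
    proof -
      have "V - X \<subseteq> V" "V - X \<noteq> {}" using X(1) by auto
      then have "4 \<le> \<delta> (V - X) + of_bool (a \<in> V - X) + of_bool (b' \<in> V - X) +
          of_bool (c' \<in> V - X) + of_bool (d' \<in> V - X)"
        using inside[of "V - X"] perm[of "V - X"] by linarith
      then show ?thesis using V(1) V' by (simp add: compl)
    qed
    show ?thesis
    proof (cases "a \<in> X")
      case True
      then show ?thesis using 1 2 X
        by (intro exI[of _ X]) (auto simp: of_bool_def split: if_splits)
    next
      case False
      then show ?thesis using 1 2 X V V' compl[of X]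
        by (intro exI[of _ "V - X"]) (auto simp: of_bool_def split: if_splits)
    qed
  qed
  show ?thesis
  proof (rule ccontr)
    assume "\<not> ?thesis"
    then have n: "\<not> good a b c d" "\<not> good a c b d" "\<not> good a d b c" by auto
    obtain X where X: "X \<subseteq> V" "\<delta> X \<le> 3" "a \<in> X" "b \<in> X" "c \<notin> X" "d \<notin> X"
      using bad[OF n(1)] V by blast
    obtain Y where Y: "Y \<subseteq> V" "\<delta> Y \<le> 3" "a \<in> Y" "c \<in> Y" "b \<notin> Y" "d \<notin> Y"
      using bad[OF n(2)] V by (auto simp: add.commute add.left_commute)
    obtain Z where Z: "Z \<subseteq> V" "\<delta> Z \<le> 3" "a \<in> Z" "d \<in> Z" "b \<notin> Z" "c \<notin> Z"
      using bad[OF n(3)] V by (auto simp: add.commute add.left_commute)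
    \<comment> \<open>Each of the four regions holds exactly one of the neighbours, so its cut size
      is at least 3: together 12, against at most 9 for \<open>X\<close>, \<open>Y\<close> and
      \<open>Z\<close>.\<close>
    have "\<delta> (X \<inter> Y \<inter> Z) \<ge> 3" using inside[of "X \<inter> Y \<inter> Z"] X Y Z by fastforce
    moreover have "\<delta> (X - Y - Z) \<ge> 3" using inside[of "X - Y - Z"] X Y Z by fastforce
    moreover have "\<delta> (Y - X - Z) \<ge> 3" using inside[of "Y - X - Z"] X Y Z by fastforce
    moreover have "\<delta> (Z - X - Y) \<ge> 3" using inside[of "Z - X - Y"] X Y Z by fastforce
    ultimately show False
      using cut_size_three[of i E X Y Z] X(2) Y(2) Z(2) unfolding \<delta>_def by linarith
  qed
qed

section \<open>The induction for ear decompositions\<close>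

lemma deg_pos: "deg i M v > 0 \<Longrightarrow> \<exists>e. e \<in># M \<and> inc (i e) v > 0"
  by (induction M) auto

lemma staged_verts:
  assumes "staged (ear i r) i h cs k" "c \<in> set cs" "v \<in> walk_verts c"
  shows "\<exists>e. e \<in># edges_of cs \<and> v \<in> set_uprod (i e)"
proof -
  obtain A B where cs: "cs = A @ c # B" using assms(2) by (meson split_list)
  obtain u p where c: "c = (u, p)" by (cases c)
  obtain h' k' where e: "ear i r h' k' (u, p)" using assms(1) by (auto simp: cs c)
  have "deg i (walk_edges p) v > 0"
    using deg_walk_pos[OF earD(2,1)[OF e]] assms(3) c by auto
  then obtain e where "e \<in># walk_edges p" "inc (i e) v > 0"
    using deg_pos[of i "walk_edges p" v] by blast
  moreover from this(2) have "v \<in> set_uprod (i e)"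
    by (cases "i e") (auto split: if_splits)
  ultimately show ?thesis by (intro exI[of _ e]) (simp add: cs c)
qed

lemma deg_ends_cong:
  assumes "\<And>e. e \<in># M \<Longrightarrow> i e = i' e"
  shows "deg i M = deg i' M"
  using assms by (auto simp: deg_def fun_eq_iff intro!: arg_cong[of _ _ sum_mset] image_mset_cong)

lemma walk_ends_cong:
  "walk i u p \<Longrightarrow> (\<And>e. e \<in># walk_edges p \<Longrightarrow> i e = i' e) \<Longrightarrow> walk i' u p"
  by (induction i u p rule: walk.induct) auto

text \<open>After pinching, the split-off edges are gone, so the auxiliary end map can be exchanged
  for the original one.\<close>

lemma staged_ends_cong:
  assumes "staged (ear i r) i h cs k" "\<And>e. e \<in># edges_of cs \<Longrightarrow> i e = i' e"
  shows "staged (ear i' r) i' h cs k"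
  using assms
proof (induction cs arbitrary: h)
  case (Cons c cs)
  have d: "deg i (edges_of cs) = deg i' (edges_of cs)"
    "deg i (walk_edges (snd c)) = deg i' (walk_edges (snd c))"
    using Cons.prems(2) by (auto intro!: deg_ends_cong)
  obtain u p where c: "c = (u, p)" by (cases c)
  have "ear i r h (\<lambda>v. deg i (edges_of cs) v + k v) (u, p)" using Cons.prems(1) by (simp add: c)
  then have "ear i' r h (\<lambda>v. deg i (edges_of cs) v + k v) (u, p)"
    using walk_ends_cong[of i u p i'] Cons.prems(2) by (auto simp: ear.simps c)
  moreover have "staged (ear i' r) i' (\<lambda>v. h v + deg i (walk_edges (snd c)) v) cs k"
    using Cons.prems by (intro Cons.IH) auto
  ultimately show ?case by (simp add: c d[unfolded c snd_conv])
qed simp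

lemma card_4_split:
  assumes "card F = 4"
  obtains a b c d where "F = {a, b, c, d}" "distinct [a, b, c, d]"
proof -
  obtain xs where xs: "set xs = F" "distinct xs" "length xs = 4"
    using assms by (metis card.infinite distinct_card finite_distinct_list zero_neq_numeral)
  then obtain a b c d where "xs = [a, b, c, d]"
    by (auto simp: numeral_eq_Suc length_Suc_conv)
  then show ?thesis using xs that by auto
qed

text \<open>Edges are natural numbers so that fresh names are available for the two edges that are split off.\<close>

theorem ear_decomposition:
  fixes i :: "nat \<Rightarrow> 'v uprod"
  assumes "finite V" "r \<in> V" "finite E" "\<And>e. e \<in> E \<Longrightarrow> set_uprod (i e) \<subseteq> V"
    and "\<And>X. X \<subset> V \<Longrightarrow> X \<noteq> {} \<Longrightarrow> cut_size i E X \<ge> 4"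
  shows "\<exists>cs. staged (ear i r) i (\<lambda>_. 0) cs (\<lambda>_. 0) \<and> edges_of cs = mset_set E"
  using assms
proof (induction "card E" arbitrary: i V E rule: less_induct)
  case less
  note fin = less.prems(1,3) and r = less.prems(2) and ends = less.prems(4) and cut = less.prems(5)
  have deg4: "deg i' (mset_set E') v \<ge> 4"
    if "\<And>X. X \<subset> V' \<Longrightarrow> X \<noteq> {} \<Longrightarrow> cut_size i' E' X \<ge> 4" "v \<in> V'" "v \<noteq> r" "r \<in> V'"
    for i' and E' :: "nat set" and V' :: "'v set" and v
    using that(1)[of "{v}"] that(2-4) cut_size_le_deg[of i' E' v] by fastforce
  show ?case
  proof (cases "\<exists>e \<in> E. \<forall>X. X \<subset> V \<longrightarrow> crosses (i e) X \<longrightarrow> cut_size i E X \<ge> 5")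
    case True
    \<comment> \<open>Loops belong to this case, as they cross no set; hence there are none in the
      other case.\<close>
    then obtain e where e: "e \<in> E" "\<And>X. X \<subset> V \<Longrightarrow> crosses (i e) X \<Longrightarrow> cut_size i E X \<ge> 5" by blast
    have cut': "cut_size i (E - {e}) X \<ge> 4" if "X \<subset> V" "X \<noteq> {}" for X
    proof -
      have "cut_size i E X = of_bool (crosses (i e) X) + cut_size i (E - {e}) X"
        unfolding cut_size_def using fin e by (intro sum.remove)
      then show ?thesis using cut[OF that] e(2)[OF that(1)] by (cases "crosses (i e) X") auto
    qed
    have "card (E - {e}) < card E" using fin(2) e(1) by (rule card_Diff1_less)
    then obtain cs where cs: "staged (ear i r) i (\<lambda>_. 0) cs (\<lambda>_. 0)" "edges_of cs = mset_set (E - {e})"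
      using less.hyps[of "E - {e}" V i] fin r ends cut' by auto
    obtain x y where xy: "i e = Upair x y" by (rule uprod_cases)
    have "x \<in> V" "y \<in> V" using ends[OF e(1)] xy by auto
    then obtain cs' where "staged (ear i r) i (\<lambda>_. 0) cs' (\<lambda>_. 0)" "edges_of cs' = add_mset e (edges_of cs)"
      using insert_edge[OF cs(1) _ xy] deg4[of V i "E - {e}"] cut' r cs(2) by auto
    then show ?thesis using cs(2) e(1) fin(2)
      by (metis finite_Diff insertCI insert_Diff_single insert_absorb mset_set.insert_remove)
  next
    case False
    show ?thesis
    proof (cases "E = {}")
      case True
      then show ?thesis by (intro exI[of _ "[]"]) simp
    next
      case nonempty: False
      have tight: "\<exists>X. X \<subset> V \<and> crosses (i e) X \<and> cut_size i E X = 4" if e: "e \<in> E" for e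
      proof -
        obtain X where "X \<subset> V" "crosses (i e) X" "\<not> cut_size i E X \<ge> 5" using False e by blast
        moreover from this have "cut_size i E X \<ge> 4" by (intro cut) (auto simp: crosses_def)
        ultimately show ?thesis by (intro exI[of _ X]) auto
      qed
      obtain w where w: "w \<in> V" "w \<noteq> r" "cut_size i E {w} = 4"
        using tight_vertex[OF fin(1) r ends nonempty cut tight] by blast
      define F where "F = {e \<in> E. crosses (i e) {w}}"
      define E0 where "E0 = E - F"
      define V' where "V' = V - {w}"
      have "card F = 4" using w(3) fin(2) unfolding cut_size_def F_def
        by (simp add: sum.If_cases of_bool_def Int_def)
      have F: "\<exists>n \<in> V'. i g = Upair n w" if "g \<in> F" for g
      proof -
        obtain p q where "i g = Upair p q" by (rule uprod_cases)
        moreover from this have "(p = w) \<noteq> (q = w)" "p \<in> V" "q \<in> V"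
          using that ends[of g] by (auto simp: F_def)
        ultimately show ?thesis unfolding V'_def by (auto simp: Upair_inject)
      qed
      \<comment> \<open>Every edge lies in a tight cut and so is no loop; thus \<open>F\<close>
        consists of all edges at \<open>w\<close>.\<close>
      have E0: "set_uprod (i e) \<subseteq> V'" if "e \<in> E0" for e
      proof -
        obtain p q where pq: "i e = Upair p q" by (rule uprod_cases)
        have "e \<in> E" "\<not> crosses (i e) {w}" using that by (auto simp: E0_def F_def)
        then have "(p = w) = (q = w)" "p \<noteq> q" "p \<in> V" "q \<in> V"
          using tight[of e] ends[of e] pq by auto
        then show ?thesis unfolding V'_def by (auto simp: pq)
      qed
      obtain g1 g2 g3 g4 where g: "F = {g1, g2, g3, g4}" "distinct [g1, g2, g3, g4]"
        by (rule card_4_split[OF \<open>card F = 4\<close>])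
      \<comment> \<open>The neighbours need not be distinct; if two of them coincide, an edge split
        off may be a loop.\<close>
      obtain n1 n2 n3 n4 where n: "n1 \<in> V'" "n2 \<in> V'" "n3 \<in> V'" "n4 \<in> V'"
        "i g1 = Upair n1 w" "i g2 = Upair n2 w" "i g3 = Upair n3 w" "i g4 = Upair n4 w"
        using F[of g1] F[of g2] F[of g3] F[of g4] g(1) by blast
      have E: "E = E0 \<union> F" "E0 \<inter> F = {}" "finite E0" "finite F" "F \<subseteq> E"
        using fin(2) by (auto simp: E0_def F_def)
      have cutF: "w \<notin> X \<Longrightarrow> cut_size i F X = of_bool (n1 \<in> X) + of_bool (n2 \<in> X) + of_bool (n3 \<in> X) + of_bool (n4 \<in> X)"
        for X
        using g(2) n(5-8) by (simp add: cut_size_def g(1))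
      have cutE: "cut_size i E X = cut_size i E0 X + cut_size i F X" for X
        unfolding cut_size_def E(1) by (rule sum.union_disjoint[OF E(3,4,2)])
      have inside: "4 \<le> cut_size i E0 X + of_bool (n1 \<in> X) + of_bool (n2 \<in> X) +
          of_bool (n3 \<in> X) + of_bool (n4 \<in> X)" if "X \<subseteq> V'" "X \<noteq> {}" for X
      proof -
        have "X \<subset> V" "w \<notin> X" using that w(1) by (auto simp: V'_def)
        then show ?thesis using cut[of X] that(2) cutE[of X] cutF[of X] by linarith
      qed
      have split: ?thesis
        if good: "\<forall>X. X \<subset> V' \<longrightarrow> X \<noteq> {} \<longrightarrow>
            4 \<le> cut_size i E0 X + of_bool ((a \<in> X) \<noteq> (b \<in> X)) + of_bool ((c \<in> X) \<noteq> (d \<in> X))"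
          and V: "a \<in> V'" "b \<in> V'" "c \<in> V'" "d \<in> V'"
          and F': "F = {ga, gb, gc, gd}" "distinct [ga, gb, gc, gd]"
          and ids: "i ga = Upair a w" "i gb = Upair b w" "i gc = Upair c w" "i gd = Upair d w"
        for a b c d ga gb gc gd
      proof -
        obtain e where e: "e \<notin> E" using ex_new_if_finite[OF infinite_UNIV_nat fin(2)] by blast
        obtain f where f: "f \<notin> insert e E"
          using ex_new_if_finite[OF infinite_UNIV_nat finite.insertI[OF fin(2)]] by blast
        define i' where "i' = i(e := Upair a b, f := Upair c d)"
        define E' where "E' = insert e (insert f E0)"
        have i': "i' g = i g" if "g \<in> E" for g using that e f by (auto simp: i'_def)
        have ef: "i' e = Upair a b" "i' f = Upair c d" "e \<noteq> f" "e \<notin> E0" "f \<notin> E0"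
          using e f E by (auto simp: i'_def)
        have cutE0: "cut_size i' E0 X = cut_size i E0 X" for X
          unfolding cut_size_def using i' E by (intro sum.cong) auto
        have cut': "cut_size i' E' X \<ge> 4" if "X \<subset> V'" "X \<noteq> {}" for X
        proof -
          have "cut_size i' E' X = of_bool (crosses (i' e) X) + (of_bool (crosses (i' f) X) + cut_size i' E0 X)"
            unfolding E'_def cut_size_def using ef E by simp
          then show ?thesis using good that by (simp add: ef cutE0 ac_simps)
        qed
        have ends': "set_uprod (i' g) \<subseteq> V'" if "g \<in> E'" for g
          using that E0[of g] i'[of g] V ef E unfolding E'_def by auto
        \<comment> \<open>Four edges are traded for two, whence the decrease in the
          induction.\<close>
        have "card E = card E0 + 4"
          using E \<open>card F = 4\<close> by (simp add: card_Un_disjoint)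
        moreover have "card E' = card E0 + 2" unfolding E'_def using ef E by simp
        ultimately have "card E' < card E" by simp
        moreover have "finite V'" "finite E'" "r \<in> V'" using fin E w r by (auto simp: V'_def E'_def)
        ultimately obtain cs where cs: "staged (ear i' r) i' (\<lambda>_. 0) cs (\<lambda>_. 0)"
            "edges_of cs = mset_set E'"
          using less.hyps[of E' V' i'] ends' cut' by auto
        have verts: "v \<in> V'" if "x \<in> set cs" "v \<in> walk_verts x" for x v
          using staged_verts[OF cs(1) that] cs(2) \<open>finite E'\<close> ends' by auto
        have "\<exists>cs'. staged (ear i' r) i' (\<lambda>_. 0) cs' (\<lambda>_. 0) \<and>
          edges_of cs' + {#e, f#} = edges_of cs + {#ga, gb, gc, gd#}"
        proof (rule pinch[OF cs(1) _ _ ef(3,1,2)])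
          show "i' ga = Upair a w" "i' gb = Upair b w" "i' gc = Upair c w" "i' gd = Upair d w"
            using i' E(5) F'(1) ids by auto
          show "w \<notin> walk_verts x" if "x \<in> set cs" for x
            using verts[OF that] by (auto simp: V'_def)
          show "4 \<le> deg i' (edges_of cs) v" if "x \<in> set cs" "v \<in> walk_verts x" "v \<noteq> r" for x v
            unfolding cs(2) by (rule deg4[OF cut' verts[OF that(1,2)] that(3) \<open>r \<in> V'\<close>])
        qed (use w cs(2) \<open>finite E'\<close> in \<open>auto simp: E'_def\<close>)
        then obtain cs' where cs': "staged (ear i' r) i' (\<lambda>_. 0) cs' (\<lambda>_. 0)"
          "edges_of cs' + {#e, f#} = edges_of cs + {#ga, gb, gc, gd#}" by blast
        have "edges_of cs = mset_set E0 + {#e, f#}"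
          unfolding cs(2) E'_def using ef E by simp
        then have "edges_of cs' = mset_set E0 + {#ga, gb, gc, gd#}" using cs'(2) by simp
        also have "\<dots> = mset_set E0 + mset_set F" using F' by simp
        also have "\<dots> = mset_set E" using E by (simp add: mset_set_Union)
        finally have edges: "edges_of cs' = mset_set E" .
        have "staged (ear i r) i (\<lambda>_. 0) cs' (\<lambda>_. 0)"
          using i' fin(2) by (intro staged_ends_cong[OF cs'(1)]) (auto simp: edges)
        then show ?thesis using edges by blast
      qed
      have g': "F = {g1, g3, g2, g4}" "distinct [g1, g3, g2, g4]"
        "F = {g1, g4, g2, g3}" "distinct [g1, g4, g2, g3]"
        using g by auto
      define good where "good a b c d \<longleftrightarrow> (\<forall>X. X \<subset> V' \<longrightarrow> X \<noteq> {} \<longrightarrow>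
          4 \<le> cut_size i E0 X + of_bool ((a \<in> X) \<noteq> (b \<in> X)) + of_bool ((c \<in> X) \<noteq> (d \<in> X)))"
        for a b c d
      have "good n1 n2 n3 n4 \<or> good n1 n3 n2 n4 \<or> good n1 n4 n2 n3"
        unfolding good_def by (rule splitting[OF E0 n(1-4) inside])
      moreover note split[folded good_def, OF _ n(1,2,3,4) g n(5,6,7,8)]
        split[folded good_def, OF _ n(1,3,2,4) g'(1,2) n(5,7,6,8)]
        split[folded good_def, OF _ n(1,4,2,3) g'(3,4) n(5,8,6,7)]
      ultimately show ?thesis by argo
    qed
  qed
qed

subsection \<open>From ears to chains\<close>

text \<open>The alternatives are an up chain that is a path, a down chain that is a path, a down chain that is
  a cycle, and a one-way chain; up chains that are cycles do not occur.\<close>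

fun link :: "('e \<Rightarrow> 'v uprod) \<Rightarrow> 'v \<Rightarrow> ('v \<Rightarrow> nat) \<Rightarrow> ('v \<Rightarrow> nat) \<Rightarrow> 'v \<times> ('e \<times> 'v) list \<Rightarrow> bool" where
  "link i r h k (u, p) \<longleftrightarrow> p \<noteq> [] \<and> walk i u p \<and>
     (distinct (u # map snd p) \<and> (\<forall>x \<in> walk_verts (u, p). late r k x) \<and> met r h u \<and> met r h (target u p) \<or>
      distinct (u # map snd p) \<and> (\<forall>x \<in> walk_verts (u, p). late r h x) \<and> met r k u \<and> met r k (target u p) \<or>
      distinct (map snd p) \<and> target u p = u \<and> (\<forall>x \<in> walk_verts (u, p). late r h x) \<and> late r k u \<or>
      length p = 1 \<and> late r h u \<and> late r k (target u p))"

text \<open>A rising ear need not be an up chain, since its ends may have no later edges; its two extreme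
  edges then become one-way chains.\<close>

lemma rising_links:
  assumes e: "ear i r h k (u, p)" and up: "rising r h u p"
    and deg4: "\<And>x. x \<in> set (inner p) \<Longrightarrow> h x + deg i (walk_edges p) x + k x \<ge> 4"
  shows "\<exists>N. staged (link i r) i h N k \<and> edges_of N = walk_edges p"
proof -
  obtain e1 x1 p1 where p1: "p = (e1, x1) # p1" "p1 \<noteq> []"
    using up by (cases p) (auto simp: rising_def Suc_le_eq)
  then obtain q e2 v where p: "p = (e1, x1) # q @ [(e2, v)]" by (metis rev_exhaust surj_pair)
  let ?t = "target x1 q"
  have inn: "inner p = x1 # map snd q" by (simp add: p)
  have tv: "?t \<in> set (inner p)" using target_in_verts[of x1 q] unfolding inn by auto
  have w: "i e1 = Upair u x1" "walk i x1 q" "i e2 = Upair v ?t" "i e2 = Upair ?t v"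
    using earD(2)[OF e] by (auto simp: p Upair_inject)
  \<comment> \<open>An inner vertex has no earlier edge and two on the ear, so at least two of its
    four edges follow.\<close>
  have lk: "late r k x" if "x \<in> set (inner p)" for x
    using deg4[OF that] deg_walk_inner[OF earD(2-5)[OF e] that] up that
    by (auto simp: rising_def late_def)
  have lu: "late r h u" "late r h v" using up by (auto simp: rising_def p)
  \<comment> \<open>The extreme edges come first, directed inwards; they provide the earlier edges
    at the ends of the middle path, which thereby becomes an up chain. If \<open>q\<close> is empty,
    there is no middle path.\<close>
  let ?N = "[(u, [(e1, x1)]), (v, [(e2, ?t)])] @ nontrivial x1 q"
  have 1: "link i r h (\<lambda>v. deg i (add_mset e2 (walk_edges q)) v + k v) (u, [(e1, x1)])"
    using w lu late_mono[OF lk[of x1]] by (auto simp: inn)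
  have 2: "link i r (\<lambda>v. h v + deg i {#e1#} v) (\<lambda>v. deg i (walk_edges q) v + k v) (v, [(e2, ?t)])"
    using w late_mono[OF lu(2)] late_mono[OF lk[OF tv]] by auto
  have 3: "link i r (\<lambda>v. h v + deg i {#e1, e2#} v) k (x1, q)" if "q \<noteq> []"
  proof -
    have "distinct (x1 # map snd q)" using earD(3)[OF e] unfolding inn .
    moreover have "late r k x" if "x \<in> walk_verts (x1, q)" for x
      using that lk[of x] unfolding inn by (auto simp: walk_verts_Pair)
    ultimately show ?thesis using that w by (auto simp: met_def)
  qed
  have "staged (link i r) i h ?N k" using 1 2 3 by (simp add: ac_simps del: link.simps)
  then show ?thesis by (intro exI[of _ ?N]) (simp add: p del: link.simps)
qed

lemma ear_links:
  assumes e: "ear i r h k (u, p)"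
    and deg4: "\<And>x. x \<in> walk_verts (u, p) \<Longrightarrow> x \<noteq> r \<Longrightarrow> h x + deg i (walk_edges p) x + k x \<ge> 4"
  shows "\<exists>N. staged (link i r) i h N k \<and> edges_of N = walk_edges p"
  using e
proof (cases rule: ear_cases)
  case rising
  show ?thesis
  proof (rule rising_links[OF e rising])
    fix x assume "x \<in> set (inner p)"
    then show "h x + deg i (walk_edges p) x + k x \<ge> 4"
      using rising walk_verts_conv[OF earD(1)[OF e], of u] by (intro deg4) (auto simp: rising_def)
  qed
next
  case falling
  have "link i r h k (u, p)"
    using earD[OF e] falling map_snd_conv[OF earD(1)[OF e], of u]
    by (cases "u = target u p") (auto simp: falling_def)
  then show ?thesis by (intro exI[of _ "[(u, p)]"]) simp
next
  case bridging
  then obtain e0 v where p: "p = [(e0, v)]" by (auto simp: bridging_def length_Suc_conv)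
  have "link i r h k (u, [(e0, v)]) \<or> link i r h k (v, [(e0, u)])"
    using bridging earD(2)[OF e] by (auto simp: bridging_def p Upair_inject)
  then show ?thesis
    using exI[of "\<lambda>N. staged (link i r) i h N k \<and> edges_of N = walk_edges p" "[(u, [(e0, v)])]"]
      exI[of "\<lambda>N. staged (link i r) i h N k \<and> edges_of N = walk_edges p" "[(v, [(e0, u)])]"]
    by (simp add: p del: link.simps) blast
qed

lemma staged_links:
  assumes "staged (ear i r) i h cs k"
    and "\<And>c x. c \<in> set cs \<Longrightarrow> x \<in> walk_verts c \<Longrightarrow> x \<noteq> r \<Longrightarrow> h x + deg i (edges_of cs) x + k x \<ge> 4"
  shows "\<exists>ds. staged (link i r) i h ds k \<and> edges_of ds = edges_of cs"
  using assms
proof (induction cs arbitrary: h)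
  case Nil
  show ?case by (intro exI[of _ "[]"]) simp
next
  case (Cons c cs)
  obtain u p where c: "c = (u, p)" by (cases c)
  have e: "ear i r h (\<lambda>v. deg i (edges_of cs) v + k v) (u, p)"
    and st: "staged (ear i r) i (\<lambda>v. h v + deg i (walk_edges p) v) cs k"
    using Cons.prems(1) by (simp_all add: c)
  obtain N where N: "staged (link i r) i h N (\<lambda>v. deg i (edges_of cs) v + k v)"
    "edges_of N = walk_edges p"
    using ear_links[OF e] Cons.prems(2)[of c] by (auto simp: c add.assoc)
  obtain ds where ds: "staged (link i r) i (\<lambda>v. h v + deg i (walk_edges p) v) ds k"
    "edges_of ds = edges_of cs"
  proof -
    have "h x + deg i (walk_edges p) x + deg i (edges_of cs) x + k x \<ge> 4"
      if "d \<in> set cs" "x \<in> walk_verts d" "x \<noteq> r" for d x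
      using Cons.prems(2)[of d x] that by (simp add: c)
    then show ?thesis using Cons.IH[OF st] that by blast
  qed
  have "staged (link i r) i h (N @ ds) k" using N ds by simp
  then show ?case using N ds by (intro exI[of _ "N @ ds"]) (simp add: c)
qed

section \<open>Transport along a renaming of the edges\<close>

definition rename_walk :: "('a \<Rightarrow> 'e) \<Rightarrow> 'v \<times> ('a \<times> 'v) list \<Rightarrow> 'v \<times> ('e \<times> 'v) list" where
  "rename_walk \<phi> c = (fst c, map (map_prod \<phi> id) (snd c))"

lemma walk_rename: "walk i u (map (map_prod \<phi> id) p) \<longleftrightarrow> walk (i \<circ> \<phi>) u p"
  by (induction u p rule: target.induct) auto

lemma target_rename: "target u (map (map_prod \<phi> id) p) = target u p"
  by (induction u p rule: target.induct) auto

lemma walk_edges_rename: "walk_edges (map (map_prod \<phi> id) p) = image_mset \<phi> (walk_edges p)"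
  by (induction p) auto

lemma walk_edges_rename_walk [simp]:
  "walk_edges (snd (rename_walk \<phi> c)) = image_mset \<phi> (walk_edges (snd c))"
  by (simp add: rename_walk_def walk_edges_rename)

lemma edges_of_rename: "edges_of (map (rename_walk \<phi>) cs) = image_mset \<phi> (edges_of cs)"
  by (induction cs) auto

lemma deg_image_mset: "deg i (image_mset \<phi> M) = deg (i \<circ> \<phi>) M"
  by (simp add: deg_def fun_eq_iff image_mset.compositionality comp_def)

lemma link_rename: "link (i \<circ> \<phi>) r h k c \<Longrightarrow> link i r h k (rename_walk \<phi> c)"
proof (cases c)
  case (Pair u p)
  have "map snd (map (map_prod \<phi> id) p) = map snd p" by simp
  moreover have "walk_verts (u, map (map_prod \<phi> id) p) = walk_verts (u, p)"
    by (force simp: walk_verts_Pair)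
  moreover assume "link (i \<circ> \<phi>) r h k c"
  ultimately show ?thesis
    by (simp add: Pair rename_walk_def walk_rename target_rename del: map_map)
qed

lemma staged_rename:
  "staged (link (i \<circ> \<phi>) r) (i \<circ> \<phi>) h cs k \<Longrightarrow> staged (link i r) i h (map (rename_walk \<phi>) cs) k"
proof (induction cs arbitrary: h)
  case (Cons c cs)
  have "link (i \<circ> \<phi>) r h (\<lambda>v. deg (i \<circ> \<phi>) (edges_of cs) v + k v) c"
    using Cons.prems by (simp add: comp_def del: link.simps)
  from link_rename[OF this] Cons show ?case
    by (simp add: edges_of_rename deg_image_mset comp_def del: link.simps)
qed simp

text \<open>If fewer than \<open>k\<close> edges crossed \<open>X\<close>, they could all be
  deleted; but a path from inside \<open>X\<close> to the outside must leave \<open>X\<close> at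
  some step.\<close>

lemma edge_connected_cut:
  assumes G: "multigraph G" and con: "edge_connected k G"
    and X: "X \<subset> verts G" "X \<noteq> {}"
  shows "k \<le> cut_size (ends G) (edges G) X"
proof (rule ccontr)
  assume less: "\<not> ?thesis"
  define F where "F = {e \<in> edges G. crosses (ends G e) X}"
  have "card F = cut_size (ends G) (edges G) X"
    using G unfolding cut_size_def F_def multigraph_def
    by (simp add: sum.If_cases of_bool_def Int_def)
  then have "connected_graph (delete_edges G F)"
    using con less unfolding edge_connected_def F_def by auto
  moreover obtain u v where uv: "u \<in> X" "u \<in> verts G" "v \<in> verts G" "v \<notin> X" using X by blast
  ultimately obtain P where P: "subgraph P (delete_edges G F)" "path_between P u v"
    unfolding connected_graph_def delete_edges_def by auto
  obtain xs es where xs: "length xs = Suc (length es)" "edges P = set es" "hd xs = u" "last xs = v"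
      "\<And>j. j < length es \<Longrightarrow> ends P (es ! j) = Upair (xs ! j) (xs ! Suc j)"
    using P(2) unfolding path_between_def by blast
  have "xs \<noteq> []" using xs(1) by auto
  then have xn: "xs ! 0 \<in> X" "xs ! length es \<notin> X"
    using xs(1,3,4) uv by (auto simp: hd_conv_nth last_conv_nth)
  have "\<exists>j<length es. xs ! j \<in> X \<and> xs ! Suc j \<notin> X"
  proof (rule ccontr)
    assume no: "\<not> ?thesis"
    have "xs ! j \<in> X" if "j \<le> length es" for j
      using that by (induction j) (use no xn in auto)
    then show False using xn(2) by blast
  qed
  then obtain j where j: "j < length es" "xs ! j \<in> X" "xs ! Suc j \<notin> X" by blast
  have "ends P = ends G" "es ! j \<in> edges G - F"
    using P(1) xs(2) j(1) unfolding subgraph_def delete_edges_def by auto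
  moreover have "crosses (ends P (es ! j)) X" using xs(5)[OF j(1)] j by simp
  ultimately show False unfolding F_def by auto
qed

section \<open>Walks as subgraphs of \<open>G\<close>\<close>

lemma staged_nth:
  assumes "staged Q i (\<lambda>_. 0) cs (\<lambda>_. 0)" "j < length cs"
  shows "Q (deg i (edges_of (take j cs))) (deg i (edges_of (drop (Suc j) cs))) (cs ! j)"
proof -
  have "staged Q i (\<lambda>_. 0) (take j cs @ cs ! j # drop (Suc j) cs) (\<lambda>_. 0)"
    using assms id_take_nth_drop[OF assms(2)] by simp
  then show ?thesis by simp
qed

lemma walk_nth:
  "walk i u p \<Longrightarrow> j < length p \<Longrightarrow>
     i (map fst p ! j) = Upair ((u # map snd p) ! j) ((u # map snd p) ! Suc j)"
proof (induction u p arbitrary: j rule: target.induct)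
  case (2 u e x p)
  then show ?case by (cases j) auto
qed simp

lemma last_walk: "last (u # map snd p) = target u p"
  by (induction u p rule: target.induct) auto

definition graph_of :: "('v, 'e) mgraph \<Rightarrow> 'v \<times> ('e \<times> 'v) list \<Rightarrow> ('v, 'e) mgraph" where
  "graph_of G c = \<lparr>verts = walk_verts c, edges = set_mset (walk_edges (snd c)), ends = ends G\<rparr>"

lemma graph_of_simps [simp]:
  "verts (graph_of G c) = walk_verts c" "edges (graph_of G c) = set_mset (walk_edges (snd c))"
  "ends (graph_of G c) = ends G"
  by (simp_all add: graph_of_def)

lemma path_between_graph_of:
  assumes "walk (ends G) u p" "distinct (u # map snd p)"
  shows "path_between (graph_of G (u, p)) u (target u p)"
  unfolding path_between_def
proof (intro exI conjI allI impI)
  show "hd (u # map snd p) = u" by simp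
  show "last (u # map snd p) = target u p" by (rule last_walk)
  show "length (u # map snd p) = Suc (length (map fst p))" by simp
  fix j assume "j < length (map fst p)"
  then show "ends (graph_of G (u, p)) (map fst p ! j) =
      Upair ((u # map snd p) ! j) ((u # map snd p) ! Suc j)"
    using walk_nth[OF assms(1)] by simp
qed (use assms in \<open>auto simp: walk_verts_Pair walk_edges_def\<close>)

lemma is_cycle_graph_of:
  assumes "walk (ends G) u p" "p \<noteq> []" "target u p = u" "distinct (map snd p)" "distinct (map fst p)"
  shows "is_cycle (graph_of G (u, p))"
  unfolding is_cycle_def
proof (intro exI conjI allI impI)
  \<comment> \<open>A closed walk repeats its start at the end, whereas \<open>is_cycle\<close>
    lists each vertex once and wraps around.\<close>
  let ?xs = "butlast (u # map snd p)"
  have ms: "map snd p = inner p @ [u]" using map_snd_conv[OF assms(2), of u] assms(3) by simp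
  have xs: "?xs = u # inner p" unfolding ms by (simp add: butlast_append)
  show "?xs \<noteq> []" unfolding xs by simp
  show "length ?xs = length (map fst p)" by simp
  show "distinct ?xs" using assms(4) unfolding xs ms by auto
  show "verts (graph_of G (u, p)) = set ?xs"
    using walk_verts_conv[OF assms(2), of u] assms(3) unfolding xs by simp
  fix j assume j: "j < length (map fst p)"
  have nb: "?xs ! l = (u # map snd p) ! l" if "l < length p" for l
    using that by (intro nth_butlast) auto
  have "?xs ! j = (u # map snd p) ! j" using j by (intro nb) simp
  moreover have "?xs ! (Suc j mod length ?xs) = (u # map snd p) ! Suc j"
  proof (cases "Suc j < length p")
    case True
    then have "Suc j mod length ?xs = Suc j" by simp
    then show ?thesis using nb[OF True] by simp
  next
    case False
    then have "Suc j = length p" using j by simp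
    moreover have "(u # map snd p) ! length p = u"
      using last_walk[of u p] last_conv_nth[of "u # map snd p"] assms(3) by (simp del: last.simps)
    moreover have "length p = Suc (length (inner p))" using arg_cong[OF ms, of length] by simp
    ultimately show ?thesis unfolding xs by simp
  qed
  ultimately show "ends (graph_of G (u, p)) (map fst p ! j) = Upair (?xs ! j) (?xs ! (Suc j mod length ?xs))"
    using walk_nth[OF assms(1), of j] j by simp
qed (use assms in \<open>auto simp: walk_edges_def\<close>)

text \<open>No element occurs twice in a \<open>mset_set\<close>, so two summands below it are
  disjoint and each is determined by its support.\<close>

lemma sub_mset_set:
  assumes "M + N \<subseteq># mset_set E"
  shows "set_mset M \<inter> set_mset N = {}" "mset_set (set_mset M) = M" "set_mset M \<subseteq> E"
proof -
  have c: "count M x + count N x \<le> 1" for x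
    using mset_subset_eq_count[OF assms, of x] count_mset_set(1)[of E x]
    by (cases "finite E"; cases "x \<in> E") auto
  show "set_mset M \<inter> set_mset N = {}"
  proof (rule equals0I)
    fix x assume "x \<in> set_mset M \<inter> set_mset N"
    then have "count M x > 0" "count N x > 0" by auto
    then show False using c[of x] by linarith
  qed
  show "mset_set (set_mset M) = M"
  proof (rule multiset_eqI)
    fix x show "count (mset_set (set_mset M)) x = count M x"
      using c[of x] by (cases "x \<in># M") (auto simp: not_in_iff Suc_le_eq simp flip: count_greater_zero_iff)
  qed
  have "set_mset M \<subseteq> set_mset (mset_set E)"
    using set_mset_mono[OF assms] by auto
  then show "set_mset M \<subseteq> E"
    by (cases "finite E") auto
qed

text \<open>The two summands of \<open>inc\<close> match the two cardinalities in
  \<open>degree\<close>.\<close>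

lemma degree_conv_deg:
  assumes "finite (edges H)"
  shows "degree H v = deg (ends H) (mset_set (edges H)) v"
proof -
  have "deg (ends H) (mset_set (edges H)) v =
    (\<Sum>e\<in>edges H. if v \<in> set_uprod (ends H e) then 1 else 0) + (\<Sum>e\<in>edges H. if ends H e = Upair v v then 1 else 0)"
    unfolding deg_mset_set inc_def by (rule sum.distrib)
  then show ?thesis using assms unfolding degree_def by (simp add: sum.If_cases Int_def)
qed

lemma walk_ends_subset: "walk i u p \<Longrightarrow> e \<in># walk_edges p \<Longrightarrow> set_uprod (i e) \<subseteq> walk_verts (u, p)"
  by (induction u p rule: target.induct) (auto simp: walk_verts_Pair)

lemma set_edges_of: "set_mset (edges_of cs) = (\<Union>c\<in>set cs. set_mset (walk_edges (snd c)))"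
  by (induction cs) auto

text \<open>The index \<open>m\<close> of the last chain is included in
  \<open>chain_decomposition\<close>, hence \<open>length cs - 1\<close>; as \<open>cs\<close> is
  nonempty, this subtraction is exact. Disjointness and the degrees in \<open>H\<close> and
  \<open>H'\<close> come from the multiset equation for the edges.\<close>

lemma chain_decomposition_of_links:
  fixes G :: "('v, 'e) mgraph"
  assumes G: "multigraph G" and st: "staged (link (ends G) r) (ends G) (\<lambda>_. 0) cs (\<lambda>_. 0)"
    and edges: "edges_of cs = mset_set (edges G)" and ne: "cs \<noteq> []"
  shows "chain_decomposition G r (length cs - 1) (\<lambda>j. graph_of G (cs ! j))"
proof -
  let ?i = "ends G" and ?m = "length cs - 1" and ?C = "\<lambda>j. graph_of G (cs ! j)"
  have finE: "finite (edges G)" using G by (simp add: multigraph_def)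
  have lk: "link ?i r (deg ?i (edges_of (take j cs))) (deg ?i (edges_of (drop (Suc j) cs))) (cs ! j)"
    if "j < length cs" for j
    using staged_nth[OF st that] .
  have parts: "edges_of (take j cs) + walk_edges (snd (cs ! j)) + edges_of (drop (Suc j) cs) =
      mset_set (edges G)" if "j < length cs" for j
    using arg_cong[OF id_take_nth_drop[OF that], of edges_of] edges by simp
  have walk: "walk ?i (fst (cs ! j)) (snd (cs ! j))" "snd (cs ! j) \<noteq> []" if "j < length cs" for j
    using lk[OF that] by (cases "cs ! j"; simp)+
  have E: "set_mset (walk_edges (snd (cs ! j))) \<subseteq> edges G" if "j < length cs" for j
    using arg_cong[OF parts[OF that], of set_mset] finE by auto
  have V: "walk_verts (cs ! j) \<subseteq> verts G" if "j < length cs" for j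
  proof
    fix x assume "x \<in> walk_verts (cs ! j)"
    then have "deg ?i (walk_edges (snd (cs ! j))) x > 0"
      using deg_walk_pos[OF walk[OF that]] by simp
    then obtain e where "e \<in># walk_edges (snd (cs ! j))" "inc (?i e) x > 0"
      using deg_pos[of ?i "walk_edges (snd (cs ! j))" x] by blast
    moreover from this(2) have "x \<in> set_uprod (?i e)" by (cases "?i e") (auto split: if_splits)
    ultimately show "x \<in> verts G" using E[OF that] G unfolding multigraph_def by blast
  qed
  have sub: "subgraph (?C j) G" if "j < length cs" for j
  proof -
    have "finite (walk_verts (cs ! j))" by (simp add: walk_verts_def)
    moreover have "set_uprod (?i e) \<subseteq> walk_verts (cs ! j)" if "e \<in># walk_edges (snd (cs ! j))" for e
      using walk_ends_subset[OF walk(1)[OF \<open>j < length cs\<close>] that] by simp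
    ultimately show ?thesis
      using E[OF that] V[OF that] by (auto simp: subgraph_def multigraph_def)
  qed
  have union: "subgraph (union_subgraphs G ?C I) G" if "I \<subseteq> {..<length cs}" for I
    using that sub finite_subset[OF that]
    unfolding subgraph_def multigraph_def union_subgraphs_def by (fastforce simp: subset_iff)
  have nth_edges: "(\<Union>j\<in>I. set_mset (walk_edges (snd (cs ! j)))) = set_mset (edges_of ds)"
    if "set ds = (!) cs ` I" for I ds
    unfolding set_edges_of that by simp
  have "subgraph (?C j) G \<and> edges (?C j) \<noteq> {}" if "j \<le> ?m" for j
  proof -
    have j: "j < length cs" using that ne by (cases cs) auto
    then show ?thesis using sub[OF j] walk(2)[OF j] by (cases "snd (cs ! j)") auto
  qed
  moreover have "disjoint_family_on (\<lambda>j. edges (?C j)) {..?m}"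
  proof -
    have lt: "edges (?C a) \<inter> edges (?C b) = {}" if "a < b" "b < length cs" for a b
    proof -
      have "cs ! b \<in> set (drop (Suc a) cs)"
        using nth_mem[of "b - Suc a" "drop (Suc a) cs"] that by simp
      then have in_rest: "set_mset (walk_edges (snd (cs ! b))) \<subseteq> set_mset (edges_of (drop (Suc a) cs))"
        unfolding set_edges_of by blast
      have "walk_edges (snd (cs ! a)) + edges_of (drop (Suc a) cs) \<subseteq># mset_set (edges G)"
      proof -
        have "mset_set (edges G) =
            edges_of (take a cs) + (walk_edges (snd (cs ! a)) + edges_of (drop (Suc a) cs))"
          using parts[of a] that by (simp add: add.assoc)
        then show ?thesis by simp
      qed
      from sub_mset_set(1)[OF this] in_rest show ?thesis by auto
    qed
    show ?thesis
      unfolding disjoint_family_on_def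
    proof (intro ballI impI)
      fix a b assume "a \<in> {..?m}" "b \<in> {..?m}" "a \<noteq> b"
      then have "a < length cs" "b < length cs" "a < b \<or> b < a" using ne by (cases cs; auto)+
      then show "edges (?C a) \<inter> edges (?C b) = {}" using lt[of a b] lt[of b a] by blast
    qed
  qed
  moreover have "(\<Union>j\<le>?m. edges (?C j)) = edges G"
  proof -
    have "{..?m} = {0..<length cs}" using ne by (cases cs) auto
    then have "set cs = (!) cs ` {..?m}" using nth_image[of "length cs" cs] by simp
    then show ?thesis using nth_edges[of cs "{..?m}"] edges finE by simp
  qed
  moreover have "up_chain G r H H' (?C j) \<or> down_chain G r H H' (?C j) \<or> one_way_chain G r H H' (?C j)"
    if "j \<le> ?m" and H: "H = union_subgraphs G ?C {..<j}" "H' = union_subgraphs G ?C {j<..?m}" for j H H'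
  proof -
    have j: "j < length cs" using that(1) ne by (cases cs) auto
    define A B where "A = take j cs" and "B = drop (Suc j) cs"
    obtain u p where c: "cs ! j = (u, p)" by (cases "cs ! j")
    have setA: "set A = (!) cs ` {..<j}"
      using nth_image[of j cs] j by (simp add: A_def atLeast0LessThan)
    have "B = map ((!) cs) [Suc j..<length cs]"
      unfolding B_def by (metis add_0 drop_map drop_upt map_nth)
    moreover have "{Suc j..<length cs} = {j<..?m}" using ne by (cases cs) auto
    ultimately have setB: "set B = (!) cs ` {j<..?m}" by simp
    have eA: "edges H = set_mset (edges_of A)" and eB: "edges H' = set_mset (edges_of B)"
      using nth_edges[OF setA] nth_edges[OF setB] unfolding H by (simp_all add: union_subgraphs_def)
    have ends: "ends H = ?i" "ends H' = ?i" unfolding H by (simp_all add: union_subgraphs_def)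
    have parts': "edges_of A + walk_edges p + edges_of B = mset_set (edges G)"
      using parts[OF j] by (simp add: A_def B_def c)
    have dis: "edge_disjoint H H'" "edge_disjoint H' H" "edge_disjoint (?C j) H" "edge_disjoint (?C j) H'"
      using sub_mset_set(1)[of "edges_of A" "walk_edges p + edges_of B" "edges G"]
        sub_mset_set(1)[of "walk_edges p" "edges_of B + edges_of A" "edges G"] parts'
      by (auto simp: edge_disjoint_def eA eB c ac_simps)
    have subs: "subgraph H G" "subgraph H' G" "subgraph (?C j) G"
      using j sub[OF j] unfolding H by (auto intro!: union)
    have dH: "degree H x = deg ?i (edges_of A) x" "degree H' x = deg ?i (edges_of B) x" for x
      using sub_mset_set(2)[of "edges_of A" "walk_edges p + edges_of B" "edges G"]
        sub_mset_set(2)[of "edges_of B" "edges_of A + walk_edges p" "edges G"] parts'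
      by (simp_all add: degree_conv_deg eA eB ends ac_simps)
    have "x \<in> (\<Union>l\<in>I. walk_verts (cs ! l))"
      if pos: "deg ?i (edges_of ds) x > 0" and ds: "set ds = (!) cs ` I"
        and I: "I \<subseteq> {..<length cs}" for x ds I
    proof -
      obtain e where e: "e \<in># edges_of ds" "inc (?i e) x > 0"
        using deg_pos[OF pos] by blast
      then have "x \<in> set_uprod (?i e)" by (cases "?i e") (auto split: if_splits)
      moreover obtain l where "l \<in> I" "e \<in># walk_edges (snd (cs ! l))"
        using e(1) nth_edges[OF ds] by blast
      ultimately show ?thesis
        using walk_ends_subset[OF walk(1)[of l], of e] I by auto
    qed
    moreover have "{..<j} \<subseteq> {..<length cs}" "{j<..?m} \<subseteq> {..<length cs}"
      using j by auto
    \<comment> \<open>Chains ask for membership in a vertex set, while \<open>met\<close> speaks of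
      degrees; a vertex of positive degree lies on one of the walks.\<close>
    ultimately have vH: "deg ?i (edges_of A) x > 0 \<Longrightarrow> x \<in> verts H"
      "deg ?i (edges_of B) x > 0 \<Longrightarrow> x \<in> verts H'" for x
      using setA setB unfolding H union_subgraphs_def by simp_all
    have lateD: "late r (deg ?i (edges_of A)) x \<Longrightarrow> x = r \<or> degree H x \<ge> 2"
      "late r (deg ?i (edges_of B)) x \<Longrightarrow> x = r \<or> degree H' x \<ge> 2" for x
      by (auto simp: late_def dH)
    have metD: "met r (deg ?i (edges_of A)) x \<Longrightarrow> x = r \<or> x \<in> verts H"
      "met r (deg ?i (edges_of B)) x \<Longrightarrow> x = r \<or> x \<in> verts H'" for x
      using vH[of x] by (auto simp: met_def)
    have pw: "walk ?i u p" "p \<noteq> []" using walk[OF j] by (simp_all add: c)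
    have nonempty: "edges (?C j) \<noteq> {}" using pw(2) by (cases p) (auto simp: c)
    have verts: "verts (?C j) = walk_verts (u, p)" by (simp add: c)
    have lk': "link ?i r (deg ?i (edges_of A)) (deg ?i (edges_of B)) (u, p)"
      using lk[OF j] by (simp add: A_def B_def c del: link.simps)
    then consider
        (up) "distinct (u # map snd p)" "\<forall>x \<in> walk_verts (u, p). late r (deg ?i (edges_of B)) x"
          "met r (deg ?i (edges_of A)) u" "met r (deg ?i (edges_of A)) (target u p)"
      | (down) "distinct (u # map snd p)" "\<forall>x \<in> walk_verts (u, p). late r (deg ?i (edges_of A)) x"
          "met r (deg ?i (edges_of B)) u" "met r (deg ?i (edges_of B)) (target u p)"
      | (cycle) "distinct (map snd p)" "target u p = u"
          "\<forall>x \<in> walk_verts (u, p). late r (deg ?i (edges_of A)) x" "late r (deg ?i (edges_of B)) u"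
      | (single) "length p = 1" "late r (deg ?i (edges_of A)) u" "late r (deg ?i (edges_of B)) (target u p)"
      by auto
    then show ?thesis
    proof cases
      case up
      then have "path_between (?C j) u (target u p)"
        using path_between_graph_of[OF pw(1)] by (simp add: c)
      moreover have "\<forall>x \<in> verts (?C j). x = r \<or> degree H' x \<ge> 2"
        unfolding verts using up(2) lateD by blast
      ultimately have "up_chain G r H H' (?C j)"
        unfolding up_chain_def using metD up(3,4) subs dis nonempty by metis
      then show ?thesis by blast
    next
      case down
      then have "path_between (?C j) u (target u p)"
        using path_between_graph_of[OF pw(1)] by (simp add: c)
      moreover have "\<forall>x \<in> verts (?C j). x = r \<or> degree H x \<ge> 2"
        unfolding verts using down(2) lateD by blast
      ultimately have "down_chain G r H H' (?C j)"
        unfolding down_chain_def up_chain_def using metD down(3,4) subs dis nonempty by metis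
      then show ?thesis by blast
    next
      case cycle
      have "mset_set (edges G) = walk_edges p + (edges_of A + edges_of B)"
        using parts' by (simp add: ac_simps)
      \<comment> \<open>\<open>link\<close> does not ask for distinct edges on a cycle; this comes
        from each edge of \<open>G\<close> being counted only once.\<close>
      then have "mset_set (set (map fst p)) = mset (map fst p)"
        using sub_mset_set(2)[of "walk_edges p" "edges_of A + edges_of B" "edges G"]
        by (simp add: walk_edges_def)
      from arg_cong[OF this, of size] have "distinct (map fst p)" by (intro card_distinct) simp
      then have "is_cycle (?C j)"
        using is_cycle_graph_of[OF pw cycle(2,1)] by (simp add: c)
      moreover have "\<forall>x \<in> verts (?C j). x = r \<or> degree H x \<ge> 2"
        unfolding verts using cycle(3) lateD by blast
      moreover have "\<exists>v \<in> verts (?C j). v = r \<or> degree H' v \<ge> 2"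
        unfolding verts using cycle(4) lateD by (intro bexI[of _ u]) (auto simp: walk_verts_Pair)
      ultimately have "down_chain G r H H' (?C j)"
        unfolding down_chain_def up_chain_def using subs dis by metis
      then show ?thesis by blast
    next
      case single
      then obtain e v where p: "p = [(e, v)]" by (auto simp: length_Suc_conv)
      have e: "e \<in> edges G" "?i e = Upair u v" using E[OF j] pw(1) by (auto simp: c p)
      have "e \<notin> edges H \<union> edges H'" using dis(3,4) by (auto simp: edge_disjoint_def c p)
      moreover have "?C j = \<lparr>verts = {u, v}, edges = {e}, ends = ends G\<rparr>"
        by (simp add: graph_of_def c p walk_verts_Pair insert_commute)
      moreover have "u = r \<or> degree H u \<ge> 2" "v = r \<or> degree H' v \<ge> 2"
        using lateD single by (auto simp: p)
      ultimately have "one_way_chain G r H H' (?C j)"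
        unfolding one_way_chain_def using subs(1,2) dis(1) e by metis
      then show ?thesis by blast
    qed
  qed
  ultimately show ?thesis unfolding chain_decomposition_def Let_def by blast
qed

theorem theorem3:
  fixes G :: "('v, 'e) mgraph" and r :: 'v
  assumes "multigraph G" and "edge_connected 4 G" and "r \<in> verts G"
  shows "\<exists>m C. chain_decomposition G r m C"
proof -
  let ?V = "verts G" and ?E = "edges G"
  have fin: "finite ?V" "finite ?E" using assms(1) by (auto simp: multigraph_def)
  note cut = edge_connected_cut[OF assms(1,2)]
  \<comment> \<open>The edges are numbered because the induction needs fresh ones, which the type
    \<open>'e\<close> might not offer.\<close>
  obtain \<phi> :: "nat \<Rightarrow> 'e" where \<phi>: "bij_betw \<phi> {0..<card ?E} ?E"
    using ex_bij_betw_nat_finite[OF fin(2)] by blast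
  let ?N = "{0..<card ?E}" and ?i = "ends G \<circ> \<phi>"
  have cut_eq: "cut_size ?i ?N X = cut_size (ends G) ?E X" for X
    unfolding cut_size_def using sum.reindex_bij_betw[OF \<phi>, of "\<lambda>e. of_bool (crosses (ends G e) X)"]
    by (simp only: comp_apply)
  have ends: "set_uprod (?i n) \<subseteq> ?V" if "n \<in> ?N" for n
    using bij_betwE[OF \<phi>] that assms(1) by (auto simp: multigraph_def)
  obtain cs where cs: "staged (ear ?i r) ?i (\<lambda>_. 0) cs (\<lambda>_. 0)" "edges_of cs = mset_set ?N"
    using ear_decomposition[of ?V r ?N ?i] fin(1) assms(3) ends cut by (auto simp: cut_eq)
  have deg4: "deg ?i (edges_of cs) x \<ge> 4" if "c \<in> set cs" "x \<in> walk_verts c" "x \<noteq> r" for c x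
  proof -
    have "x \<in> ?V" using staged_verts[OF cs(1) that(1,2)] ends by (auto simp: cs(2))
    then have "cut_size ?i ?N {x} \<ge> 4" unfolding cut_eq using assms(3) that(3) by (intro cut) auto
    then show ?thesis using cut_size_le_deg[of ?i ?N x] by (simp add: cs(2))
  qed
  obtain ds where ds: "staged (link ?i r) ?i (\<lambda>_. 0) ds (\<lambda>_. 0)" "edges_of ds = edges_of cs"
    using staged_links[OF cs(1)] deg4 by auto
  let ?ds = "map (rename_walk \<phi>) ds"
  have "inj_on \<phi> ?N" "\<phi> ` ?N = ?E" using \<phi> by (auto simp: bij_betw_def)
  then have edges: "edges_of ?ds = mset_set ?E"
    by (simp add: edges_of_rename ds(2) cs(2) image_mset_mset_set)
  \<comment> \<open>There is a second vertex, so \<open>{r}\<close> is a proper subset and its cut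
    has at least four edges.\<close>
  have "?E \<noteq> {}"
  proof
    assume "?E = {}"
    moreover have "{r} \<subset> ?V"
    proof -
      have "card ?V \<ge> 2" using assms(2) by (simp add: edge_connected_def)
      then have "?V \<noteq> {r}" by auto
      then show ?thesis using assms(3) by auto
    qed
    ultimately show False using cut[of "{r}"] by (simp add: cut_size_def)
  qed
  then have "?ds \<noteq> []" using edges fin(2) by (auto simp: mset_set_empty_iff)
  then show ?thesis
    using chain_decomposition_of_links[OF assms(1) staged_rename[OF ds(1)] edges] by blast
qed

end
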